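(* Let $(A,\nu,\mu)$ be a Gerstenhaber algebra. Put $\nu_1:=0$, $\nu_2:=\nu$ and, for $n\ge 3$, $\nu_n:=\mu^{n-1}\lrcorner\,\nu$, i.e. $$\nu_n(a_1\otimes\cdots\otimes a_n)=\sum_{\sigma\in \mathrm{Sh}(2,n-2)}\epsilon(\sigma)\,\nu(a_{\sigma(1)}\otimes a_{\sigma(2)})\cdot a_{\sigma(3)}\cdots a_{\sigma(n)} .$$ Then $(A,\{\nu_n\}_{n\ge1})$, restricted to positive degrees, is an $L_\infty$-algebra.
   Context: Graded vector spaces are $\mathbb Z$-graded over a field of characteristic $0$; $|v|$ is the degree of a homogeneous element. $\mathrm{Sh}(p_1,\dots,p_q)$ is the set of unshuffles: permutations $\sigma$ of $\{1,\dots,p_1+\cdots+p_q\}$ with $\sigma(i)<\sigma(i+1)$ unless $i\in\{p_1,p_1+p_2,\dots\}$. The Koszul sign $\epsilon(\sigma)$ (depending on homogeneous $v_1,\dots,v_n$) is the sign with $v_1\cdots v_n=\epsilon(\sigma)v_{\sigma(1)}\cdots v_{\sigma(n)}$ in the free graded commutative algebra. A multilinear map $g$ is symmetric if $g(v_1,\dots,v_n)=\epsilon(\sigma)g(v_{\sigma(1)},\dots,v_{\sigma(n)})$ for all $\sigma$. A Gerstenhaber algebra is presented as a triple $(A,\nu,\mu)$: $A$ is a graded vector space; $\mu$ (also written $\cdot$) is an associative graded symmetric product of degree $0$; $\nu:A\otimes A\to A$ is a symmetric map of degree $-1$ with (3-Jacobi) $\sum_{\sigma\in \mathrm{Sh}(2,1)}\epsilon(\sigma)\nu(\nu(a_{\sigma(1)},a_{\sigma(2)}),a_{\sigma(3)})=0$,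 and (Leibniz) $\nu(a,bc)=\nu(a,b)c+(-1)^{(|a|-1)|b|}b\,\nu(a,c)$. $\mu^{n}$ denotes the $n$-fold product $a_1\cdots a_n$. An $L_\infty$-algebra is a graded vector space $L$ concentrated in positive degrees with symmetric maps $l_n:L^{\otimes n}\to L$ ($n\ge1$) of degree $-1$ such that for every $n\ge1$ $$\sum_{i+j=n+1}\ \sum_{\sigma\in \mathrm{Sh}(i,j-1)}\epsilon(\sigma)\,l_j\big(l_i(x_{\sigma(1)},\dots,x_{\sigma(i)}),x_{\sigma(i+1)},\dots,x_{\sigma(n)}\big)=0 .$$ *)

theory Defs
  imports Complex_Main "HOL-Combinatorics.Permutations"
begin

text \<open>
  A graded vector space is an independent family of subspaces \<open>V i\<close>, for \<open>i\<close> an integer, of an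
  ambient vector space over \<open>'k\<close>; the space itself is the span of the family, which need not be
  the whole type. An \<open>n\<close>-ary map takes the list of its \<open>n\<close> arguments, and positions and
  permutations are indexed from 0: \<open>permute_list \<sigma> xs\<close> is the list of all \<open>xs ! \<sigma> i\<close>.
\<close>

locale graded_vector_space = vector_space scale
  for scale :: "'k::field_char_0 \<Rightarrow> 'a::ab_group_add \<Rightarrow> 'a" +
  fixes V :: "int \<Rightarrow> 'a set"
  assumes subspace_piece: "subspace (V i)"
    and independent_pieces:
      "finite I \<Longrightarrow> (\<And>i. i \<in> I \<Longrightarrow> f i \<in> V i) \<Longrightarrow> (\<Sum>i\<in>I. f i) = 0 \<Longrightarrow> i \<in> I \<Longrightarrow> f i = 0"

definition total :: "('k::field_char_0 \<Rightarrow> 'a::ab_group_add \<Rightarrow> 'a) \<Rightarrow> (int \<Rightarrow> 'a set) \<Rightarrow> 'a set" where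
  "total scale V = module.span scale (\<Union>i. V i)"

definition homogeneous :: "(int \<Rightarrow> 'a set) \<Rightarrow> int list \<Rightarrow> 'a list \<Rightarrow> bool" where
  "homogeneous V ds xs \<longleftrightarrow> list_all2 (\<lambda>d x. x \<in> V d) ds xs"

definition component :: "(int \<Rightarrow> 'a set) \<Rightarrow> int \<Rightarrow> 'a::ab_group_add \<Rightarrow> 'a" where
  "component V d x =
     (THE f. (\<forall>i. f i \<in> V i) \<and> finite {i. f i \<noteq> 0} \<and> x = (\<Sum>i | f i \<noteq> 0. f i)) d"

definition positive_part :: "(int \<Rightarrow> 'a::zero set) \<Rightarrow> int \<Rightarrow> 'a set" where
  "positive_part V i = (if 0 < i then V i else {0})"


definition unshuffles :: "nat list \<Rightarrow> (nat \<Rightarrow> nat) set" where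
  "unshuffles ps = {\<sigma>. \<sigma> permutes {..<sum_list ps} \<and>
     (\<forall>i. Suc i < sum_list ps \<longrightarrow> Suc i \<notin> {sum_list (take q ps) | q. q \<le> length ps} \<longrightarrow> \<sigma> i < \<sigma> (Suc i))}"

text \<open>
  One factor for each pair of letters that \<open>\<sigma>\<close> puts out of order. The lemma
  \<open>koszul_sign_prod_list\<close> below shows that this is the sign relating the two monomials in
  graded commuting elements.
\<close>

definition koszul_sign :: "int list \<Rightarrow> (nat \<Rightarrow> nat) \<Rightarrow> 'k::field_char_0" where
  "koszul_sign ds \<sigma> =
     (\<Prod>(i, j) \<in> {(i, j). i < j \<and> j < length ds \<and> \<sigma> j < \<sigma> i}. (-1) powi (ds ! \<sigma> i * ds ! \<sigma> j))"


definition multilinear_map ::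
  "('k::field_char_0 \<Rightarrow> 'a::ab_group_add \<Rightarrow> 'a) \<Rightarrow> (int \<Rightarrow> 'a set) \<Rightarrow> nat \<Rightarrow> ('a list \<Rightarrow> 'a) \<Rightarrow> bool" where
  "multilinear_map scale V n g \<longleftrightarrow>
     (\<forall>xs. length xs = n \<longrightarrow> set xs \<subseteq> total scale V \<longrightarrow>
        g xs \<in> total scale V \<and>
        (\<forall>k<n. \<forall>a\<in>total scale V. \<forall>b\<in>total scale V. \<forall>c.
           g (xs[k := a + b]) = g (xs[k := a]) + g (xs[k := b]) \<and>
           g (xs[k := scale c a]) = scale c (g (xs[k := a]))))"

definition has_degree :: "(int \<Rightarrow> 'a set) \<Rightarrow> nat \<Rightarrow> ('a list \<Rightarrow> 'a) \<Rightarrow> int \<Rightarrow> bool" where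
  "has_degree V n g m \<longleftrightarrow>
     (\<forall>ds xs. length xs = n \<longrightarrow> homogeneous V ds xs \<longrightarrow> g xs \<in> V (sum_list ds + m))"

definition graded_symmetric ::
  "('k::field_char_0 \<Rightarrow> 'a::ab_group_add \<Rightarrow> 'a) \<Rightarrow> (int \<Rightarrow> 'a set) \<Rightarrow> nat \<Rightarrow> ('a list \<Rightarrow> 'a) \<Rightarrow> bool" where
  "graded_symmetric scale V n g \<longleftrightarrow>
     (\<forall>ds xs \<sigma>. length xs = n \<longrightarrow> homogeneous V ds xs \<longrightarrow> \<sigma> permutes {..<n} \<longrightarrow>
        g xs = scale (koszul_sign ds \<sigma>) (g (permute_list \<sigma> xs)))"

definition binary :: "('a \<Rightarrow> 'a \<Rightarrow> 'a) \<Rightarrow> 'a list \<Rightarrow> 'a" where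
  "binary f xs = f (xs ! 0) (xs ! 1)"

text \<open>
  \<open>F ds\<close> prescribes a map on homogeneous arguments of degrees \<open>ds\<close>; its multilinear extension
  splits every argument into its finitely many homogeneous components.
\<close>

definition multilinear_extension ::
  "(int \<Rightarrow> 'a set) \<Rightarrow> (int list \<Rightarrow> 'a list \<Rightarrow> 'a) \<Rightarrow> 'a list \<Rightarrow> 'a::ab_group_add" where
  "multilinear_extension V F xs =
     (\<Sum>ds | list_all2 (\<lambda>d x. component V d x \<noteq> 0) ds xs. F ds (map2 (component V) ds xs))"


locale Gerstenhaber_algebra = graded_vector_space scale A
  for scale :: "'k::field_char_0 \<Rightarrow> 'a::ab_group_add \<Rightarrow> 'a" and A :: "int \<Rightarrow> 'a set" +
  fixes \<nu> \<mu> :: "'a \<Rightarrow> 'a \<Rightarrow> 'a"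
  assumes product_multilinear: "multilinear_map scale A 2 (binary \<mu>)"
    and product_degree: "has_degree A 2 (binary \<mu>) 0"
    and product_symmetric: "graded_symmetric scale A 2 (binary \<mu>)"
    and product_assoc:
      "a \<in> total scale A \<Longrightarrow> b \<in> total scale A \<Longrightarrow> c \<in> total scale A \<Longrightarrow> \<mu> (\<mu> a b) c = \<mu> a (\<mu> b c)"
    and bracket_multilinear: "multilinear_map scale A 2 (binary \<nu>)"
    and bracket_degree: "has_degree A 2 (binary \<nu>) (-1)"
    and bracket_symmetric: "graded_symmetric scale A 2 (binary \<nu>)"
    and bracket_Jacobi:
      "length as = 3 \<Longrightarrow> homogeneous A ds as \<Longrightarrow>
       (\<Sum>\<sigma>\<in>unshuffles [2, 1].
          scale (koszul_sign ds \<sigma>) (\<nu> (\<nu> (as ! \<sigma> 0) (as ! \<sigma> 1)) (as ! \<sigma> 2))) = 0"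
    and bracket_Leibniz:
      "a \<in> A p \<Longrightarrow> b \<in> A q \<Longrightarrow> c \<in> A r \<Longrightarrow>
       \<nu> a (\<mu> b c) = \<mu> (\<nu> a b) c + scale ((-1) powi ((p - 1) * q)) (\<mu> b (\<nu> a c))"

locale L_infinity_algebra = graded_vector_space scale L
  for scale :: "'k::field_char_0 \<Rightarrow> 'a::ab_group_add \<Rightarrow> 'a" and L :: "int \<Rightarrow> 'a set" +
  fixes l :: "nat \<Rightarrow> 'a list \<Rightarrow> 'a"
  assumes positive_degrees: "i \<le> 0 \<Longrightarrow> L i = {0}"
    and multilinear: "1 \<le> n \<Longrightarrow> multilinear_map scale L n (l n)"
    and degree: "1 \<le> n \<Longrightarrow> has_degree L n (l n) (-1)"
    and symmetric: "1 \<le> n \<Longrightarrow> graded_symmetric scale L n (l n)"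
    and Jacobi:
      "1 \<le> n \<Longrightarrow> length xs = n \<Longrightarrow> homogeneous L ds xs \<Longrightarrow>
       (\<Sum>(i, j) \<in> {(i, j). 1 \<le> i \<and> 1 \<le> j \<and> i + j = n + 1}. \<Sum>\<sigma>\<in>unshuffles [i, j - 1].
          scale (koszul_sign ds \<sigma>)
            (l j (l i (take i (permute_list \<sigma> xs)) # drop i (permute_list \<sigma> xs)))) = 0"


definition higher_bracket_hom ::
  "('k::field_char_0 \<Rightarrow> 'a::ab_group_add \<Rightarrow> 'a) \<Rightarrow> ('a \<Rightarrow> 'a \<Rightarrow> 'a) \<Rightarrow> ('a \<Rightarrow> 'a \<Rightarrow> 'a)
     \<Rightarrow> nat \<Rightarrow> int list \<Rightarrow> 'a list \<Rightarrow> 'a" where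
  "higher_bracket_hom scale \<nu> \<mu> n ds as =
     (\<Sum>\<sigma>\<in>unshuffles [2, n - 2].
        scale (koszul_sign ds \<sigma>)
          (foldl \<mu> (\<nu> (as ! \<sigma> 0) (as ! \<sigma> 1)) (map (\<lambda>i. as ! \<sigma> i) [2..<n])))"

text \<open>
  On homogeneous arguments this is the displayed sum of \<open>higher_bracket_hom\<close>; see the lemma
  \<open>higher_bracket_homogeneous\<close> below.
\<close>

definition higher_bracket ::
  "('k::field_char_0 \<Rightarrow> 'a::ab_group_add \<Rightarrow> 'a) \<Rightarrow> (int \<Rightarrow> 'a set) \<Rightarrow> ('a \<Rightarrow> 'a \<Rightarrow> 'a) \<Rightarrow> ('a \<Rightarrow> 'a \<Rightarrow> 'a)
     \<Rightarrow> nat \<Rightarrow> 'a list \<Rightarrow> 'a" where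
  "higher_bracket scale A \<nu> \<mu> n =
     (if n \<le> 1 then (\<lambda>as. 0)
      else if n = 2 then binary \<nu>
      else multilinear_extension A (higher_bracket_hom scale \<nu> \<mu> n))"


lemma koszul_sign_prod_list:
  fixes scale :: "'k::field_char_0 \<Rightarrow> 'r::ring_1 \<Rightarrow> 'r" and v :: "'r list"
  assumes "vector_space scale"
    and scale_mult: "\<And>c x y. scale c x * y = scale c (x * y)" "\<And>c x y. x * scale c y = scale c (x * y)"
    and len: "length ds = length v"
    and comm: "\<And>i j. i < length v \<Longrightarrow> j < length v \<Longrightarrow> i \<noteq> j \<Longrightarrow>
                 v ! i * v ! j = scale ((-1) powi (ds ! i * ds ! j)) (v ! j * v ! i)"
    and perm: "\<sigma> permutes {..<length v}"
  shows "prod_list v = scale (koszul_sign ds \<sigma>) (prod_list (permute_list \<sigma> v))"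
proof -
  interpret vector_space scale by fact
  define e :: "nat \<Rightarrow> nat \<Rightarrow> 'k" where "e = (\<lambda>i j. (-1) powi (ds ! i * ds ! j))"
  define P where "P = (\<lambda>x w. prod_list (map (\<lambda>y. if y < x then e x y else 1) w))"
  define inv where "inv = (\<lambda>w. \<Prod>(i, j) \<in> {(i, j). i < j \<and> j < length w \<and> w ! j < w ! i}. e (w ! i) (w ! j))"
  have inv_alt: "inv w = (\<Prod>i<length w. \<Prod>j<length w. if i < j \<and> w ! j < w ! i then e (w ! i) (w ! j) else 1)" for w
  proof -
    have "inv w = (\<Prod>p \<in> {..<length w} \<times> {..<length w}.
        if fst p < snd p \<and> w ! snd p < w ! fst p then e (w ! fst p) (w ! snd p) else 1)"
      unfolding inv_def prod.inter_filter[OF finite_cartesian_product[OF finite_lessThan finite_lessThan], symmetric]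
      by (rule prod.cong) auto
    also have "\<dots> = (\<Prod>i<length w. \<Prod>j<length w. if i < j \<and> w ! j < w ! i then e (w ! i) (w ! j) else 1)"
      by (simp add: prod.cartesian_product case_prod_unfold)
    finally show ?thesis .
  qed
  have P_alt: "P x w = (\<Prod>j<length w. if w ! j < x then e x (w ! j) else 1)" for x w
    unfolding P_def by (induction w) (simp_all add: prod.lessThan_Suc_shift del: prod.lessThan_Suc cong: if_cong)
  have inv_Nil: "inv [] = 1" by (simp add: inv_alt)
  have inv_Cons: "inv (x # w) = P x w * inv w" for x w
    unfolding inv_alt P_alt by (simp add: prod.lessThan_Suc_shift del: prod.lessThan_Suc cong: if_cong)
  have P_sort: "P x (sort w) = P x w" for x w
    unfolding P_def prod_mset_prod_list[symmetric] by simp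
  have insort: "prod_list (map ((!) v) (insort x ys)) = scale (P x ys) (v ! x * prod_list (map ((!) v) ys))"
    if "sorted ys" "x \<notin> set ys" "x < length v" "set ys \<subseteq> {..<length v}" for x ys
    using that
  proof (induction ys)
    case Nil
    then show ?case by (simp add: P_def)
  next
    case (Cons y ys)
    show ?case
    proof (cases "x \<le> y")
      case True
      then have "P x (y # ys) = 1"
        unfolding P_alt using Cons.prems by (intro prod.neutral) (fastforce simp: nth_Cons split: nat.splits dest: nth_mem)
      with True show ?thesis by simp
    next
      case False
      have "v ! y * (v ! x * z) = scale (e x y) (v ! x * (v ! y * z))" for z
        using comm[of y x] Cons.prems False
        by (simp add: mult.assoc[symmetric] scale_mult e_def mult.commute)
      then show ?thesis using Cons False
        by (simp add: scale_mult P_def mult.commute)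
    qed
  qed
  have sort: "prod_list (map ((!) v) (sort w)) = scale (inv w) (prod_list (map ((!) v) w))"
    if "distinct w" "set w \<subseteq> {..<length v}" for w
    using that
  proof (induction w)
    case Nil
    then show ?case by (simp add: inv_Nil)
  next
    case (Cons x w)
    then show ?case
      by (simp add: insort P_sort inv_Cons scale_mult)
  qed
  let ?w = "map \<sigma> [0..<length v]"
  have dist: "distinct ?w"
    using permutes_inj[OF perm] by (simp add: distinct_map inj_on_def inj_def)
  have setw: "set ?w = {..<length v}"
    using permutes_image[OF perm] by (simp add: atLeast0LessThan)
  have "sort ?w = [0..<length v]"
    using dist setw by (intro sorted_distinct_set_unique) auto
  moreover have "map ((!) v) [0..<length v] = v" by (rule map_nth)
  moreover have "inv ?w = koszul_sign ds \<sigma>"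
    unfolding inv_def koszul_sign_def e_def by (intro prod.cong) (auto simp: len)
  moreover have "map ((!) v) ?w = permute_list \<sigma> v"
    by (simp add: permute_list_def)
  ultimately show ?thesis
    using sort[OF dist] setw by simp
qed

context graded_vector_space begin

lemma component_homogeneous:
  assumes "x \<in> V d"
  shows "component V e x = (if e = d then x else 0)"
proof -
  have zero: "0 \<in> V i" for i using subspace_piece[of i] by (rule subspace_0)
  let ?f = "\<lambda>i. if i = d then x else 0"
  have "(THE f. (\<forall>i. f i \<in> V i) \<and> finite {i. f i \<noteq> 0} \<and> x = (\<Sum>i | f i \<noteq> 0. f i)) = ?f"
  proof (rule the_equality)
    show "(\<forall>i. ?f i \<in> V i) \<and> finite {i. ?f i \<noteq> 0} \<and> x = (\<Sum>i | ?f i \<noteq> 0. ?f i)"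
      using assms zero by auto
  next
    fix f assume f: "(\<forall>i. f i \<in> V i) \<and> finite {i. f i \<noteq> 0} \<and> x = (\<Sum>i | f i \<noteq> 0. f i)"
    let ?I = "insert d {i. f i \<noteq> 0}" and ?g = "\<lambda>i. f i - (if i = d then x else 0)"
    have fin: "finite ?I" using f by simp
    have "sum f ?I = x" using f by (simp add: sum.insert_if)
    then have "sum ?g ?I = 0" using fin by (simp add: sum_subtractf)
    moreover have "?g i \<in> V i" for i
      using f assms zero subspace_piece subspace_diff by auto
    ultimately have "?g i = 0" if "i \<in> ?I" for i
      using independent_pieces[OF fin, of ?g] that by blast
    then have "f i = ?f i" for i by (cases "i \<in> ?I") auto
    then show "f = ?f" by blast
  qed
  then show ?thesis by (simp add: component_def)
qed

lemma multilinear_extension_homogeneous: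
  assumes "homogeneous V ds xs"
    and zero: "0 \<in> set xs \<Longrightarrow> F ds xs = 0"
  shows "multilinear_extension V F xs = F ds xs"
proof -
  let ?S = "{es. list_all2 (\<lambda>e x. component V e x \<noteq> 0) es xs}"
  have hom: "length ds = length xs" "\<And>i. i < length xs \<Longrightarrow> xs ! i \<in> V (ds ! i)"
    using assms(1) by (auto simp: homogeneous_def list_all2_conv_all_nth)
  have eq: "es = ds" if "es \<in> ?S" for es
    using that hom(1) component_homogeneous[OF hom(2)]
    by (intro nth_equalityI) (auto simp: list_all2_conv_all_nth split: if_splits)
  have comp: "map2 (component V) ds xs = xs"
    using hom(1) component_homogeneous[OF hom(2)] by (intro nth_equalityI) auto
  show ?thesis
  proof (cases "0 \<in> set xs")
    case True
    then obtain k where "k < length xs" "xs ! k = 0" by (auto simp: in_set_conv_nth)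
    then have "component V (ds ! k) (xs ! k) = 0"
      using component_homogeneous[OF hom(2)[of k], of "ds ! k"] by metis
    then have "ds \<notin> ?S"
      using \<open>k < length xs\<close> by (auto dest: list_all2_nthD2)
    then have "?S = {}" using eq by blast
    then show ?thesis using True zero by (simp add: multilinear_extension_def)
  next
    case False
    then have "xs ! k \<noteq> 0" if "k < length xs" for k using that by (metis nth_mem)
    then have "ds \<in> ?S"
      using hom(1) component_homogeneous[OF hom(2)] by (auto simp: list_all2_conv_all_nth)
    then have "?S = {ds}" using eq by blast
    then show ?thesis by (simp add: multilinear_extension_def comp)
  qed
qed

end

context Gerstenhaber_algebra begin

lemma piece_subset_total: "A d \<subseteq> total scale A"
  unfolding total_def using span_superset by blast

lemma zero_total: "0 \<in> total scale A"
  unfolding total_def by (rule span_zero)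

lemma binary_closed:
  assumes "multilinear_map scale A 2 (binary f)" "a \<in> total scale A" "b \<in> total scale A"
  shows "f a b \<in> total scale A"
  using assms unfolding multilinear_map_def binary_def
  by (auto dest: spec[of _ "[a, b]"])

lemma binary_zero:
  assumes f: "multilinear_map scale A 2 (binary f)" and a: "a \<in> total scale A"
  shows "f 0 a = 0" "f a 0 = 0"
proof -
  have *: "binary f ([a, a][k := scale 0 0]) = scale 0 (binary f ([a, a][k := 0]))" if "k < 2" for k
  proof -
    have "length [a, a] = 2" "set [a, a] \<subseteq> total scale A" using a by auto
    then show ?thesis using f that zero_total unfolding multilinear_map_def by blast
  qed
  show "f 0 a = 0" using *[of 0] by (simp add: binary_def)
  show "f a 0 = 0" using *[of 1] by (simp add: binary_def)
qed

lemma foldl_product_zero: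
  assumes "a \<in> total scale A" "set as \<subseteq> total scale A" "a = 0 \<or> 0 \<in> set as"
  shows "foldl \<mu> a as = 0"
  using assms
  by (induction as arbitrary: a)
    (auto simp: binary_zero[OF product_multilinear] binary_closed[OF product_multilinear])

lemma higher_bracket_homogeneous:
  assumes n: "3 \<le> n" "length as = n" and hom: "homogeneous A ds as"
  shows "higher_bracket scale A \<nu> \<mu> n as =
    (\<Sum>\<sigma>\<in>unshuffles [2, n - 2].
        scale (koszul_sign ds \<sigma>)
          (foldl \<mu> (\<nu> (as ! \<sigma> 0) (as ! \<sigma> 1)) (map (\<lambda>i. as ! \<sigma> i) [2..<n])))"
proof -
  have tot: "as ! i \<in> total scale A" if "i < n" for i
    using hom n that piece_subset_total by (fastforce simp: homogeneous_def list_all2_conv_all_nth)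
  have "higher_bracket_hom scale \<nu> \<mu> n ds as = 0" if "0 \<in> set as"
    unfolding higher_bracket_hom_def
  proof (intro sum.neutral ballI)
    fix \<sigma> assume "\<sigma> \<in> unshuffles [2, n - 2]"
    moreover have "sum_list [2, n - 2] = n" using n by simp
    ultimately have perm: "\<sigma> permutes {..<n}" unfolding unshuffles_def by (metis (mono_tags, lifting) mem_Collect_eq)
    have lt: "\<sigma> i < n" if "i < n" for i
      using permutes_in_image[OF perm, of i] that by simp
    obtain k where k: "k < n" "as ! k = 0" using \<open>0 \<in> set as\<close> n by (auto simp: in_set_conv_nth)
    obtain m where m: "m < n" "as ! \<sigma> m = 0"
      using k permutes_image[OF perm] by (metis imageE lessThan_iff)
    have "\<nu> (as ! \<sigma> 0) (as ! \<sigma> 1) = 0 \<or> 0 \<in> set (map (\<lambda>i. as ! \<sigma> i) [2..<n])"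
    proof (cases "m < 2")
      case True
      then have "m = 0 \<or> m = 1" by auto
      then show ?thesis
        using m binary_zero(1)[OF bracket_multilinear tot[OF lt[of 1]]]
          binary_zero(2)[OF bracket_multilinear tot[OF lt[of 0]]] n by auto
    next
      case False
      then show ?thesis using m by force
    qed
    moreover have "\<nu> (as ! \<sigma> 0) (as ! \<sigma> 1) \<in> total scale A"
      using n by (intro binary_closed[OF bracket_multilinear] tot lt) auto
    ultimately have "foldl \<mu> (\<nu> (as ! \<sigma> 0) (as ! \<sigma> 1)) (map (\<lambda>i. as ! \<sigma> i) [2..<n]) = 0"
      using tot lt by (intro foldl_product_zero) auto
    then show "scale (koszul_sign ds \<sigma>)
          (foldl \<mu> (\<nu> (as ! \<sigma> 0) (as ! \<sigma> 1)) (map (\<lambda>i. as ! \<sigma> i) [2..<n])) = 0" by simp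
  qed
  then have "multilinear_extension A (higher_bracket_hom scale \<nu> \<mu> n) as = higher_bracket_hom scale \<nu> \<mu> n ds as"
    by (rule multilinear_extension_homogeneous[OF hom])
  then show ?thesis using n by (simp add: higher_bracket_def higher_bracket_hom_def)
qed

end

end

theory Submission
  imports Defs
begin

text \<open>
  The idea is to evaluate everything on equal arguments. If all arguments were one element \<open>x\<close> of even
  degree, then with the odd element \<open>b = \<nu> x x\<close> one would have
  \<open>\<nu>\<^sub>n x \<dots> x = (n choose 2) b x\<^sup>n\<^sup>-\<^sup>2\<close>, and \<open>\<nu>\<^sub>j (\<nu>\<^sub>i x \<dots> x) x \<dots> x\<close> would be a combination of the two terms
  \<open>\<nu> (b x\<^sup>i\<^sup>-\<^sup>2) x \<cdot> x\<^sup>j\<^sup>-\<^sup>2\<close> and \<open>(\<nu> x x) \<cdot> (b x\<^sup>i\<^sup>-\<^sup>2) \<cdot> x\<^sup>j\<^sup>-\<^sup>3\<close>. The second contains \<open>b b\<close>, which is zero because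
  \<open>b\<close> is odd and the product is graded commutative. By the Leibniz rule the first is a combination of
  \<open>\<nu> b x\<close>, which is zero by the Jacobi identity, and again of \<open>b b\<close>. So the sum over the unshuffles in
  the \<open>L\<^sub>\<infinity>\<close> relation vanishes separately for each pair \<open>(i, j)\<close>.
  
  In characteristic zero, equal arguments can be replaced by symmetrization: the sum of
  \<open>\<epsilon>(\<sigma>) f (x\<^sub>\<sigma>)\<close> over the full symmetric group does not change when the arguments of \<open>f\<close> are permuted
  at the price of a Koszul sign (\<open>symmetrization_koszul_act\<close>). Sums over unshuffles are symmetrizations
  up to a nonzero factor, since the unshuffles represent the cosets of the group that preserves the two
  blocks and the summands are invariant under that group (\<open>symmetrization_unshuffles\<close>). This gives the
  symmetry of the higher brackets (\<open>higher_bracket_symmetric\<close>), and it reduces the \<open>(i, j)\<close> part of the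
  relation to the vanishing of the symmetrizations of two expressions:
  \<open>nested_bracket_term i\<close>, which is the first term above, and \<open>two_bracket_term i\<close>, which is the second.
  The latter is antisymmetric under the exchange of its two brackets (\<open>symmetrization_two_bracket\<close>); the
  former is treated by induction on \<open>i\<close>, where one application of the Leibniz rule produces the previous
  term and a two-bracket term, and the induction starts with the Jacobi identity
  (\<open>symmetrization_nested_bracket\<close>).
  
  Multilinearity of the brackets rests on the decomposition of an element into homogeneous components
  (\<open>multilinear_map_extension\<close>), and the passage to positive degrees only needs that a bracket of at
  least two elements of positive degree has positive degree again.
\<close>

section \<open>Koszul signs of permutations\<close>

lemma sign_powi: "(-1 :: 'k::field_char_0) powi k = (if even k then 1 else -1)"
  by (simp add: power_int_minus_left)

lemma sign_sum: "(-1 :: 'k::field_char_0) powi (\<Sum>i\<in>I. f i) = (\<Prod>i\<in>I. (-1) powi f i)"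
  by (induction I rule: infinite_finite_induct) (simp_all add: power_int_add)

lemma koszul_sign_id: "koszul_sign ds id = 1"
proof -
  have "{(i, j). i < j \<and> j < length ds \<and> id j < id i} = {}" by auto
  then show ?thesis unfolding koszul_sign_def by (simp only: prod.empty)
qed

text \<open>
  Here the index set does not depend on the permutation, so that the signs of different permutations can
  be multiplied factor by factor.
\<close>

lemma koszul_sign_pairs:
  "koszul_sign ds \<sigma> = (\<Prod>(i, j) \<in> {(i, j). i < j \<and> j < length ds}.
     if \<sigma> j < \<sigma> i then (-1 :: 'k::field_char_0) powi (ds ! \<sigma> i * ds ! \<sigma> j) else 1)"
proof -
  have fin: "finite {(i, j). i < j \<and> j < length ds}"
    by (rule finite_subset[of _ "{..<length ds} \<times> {..<length ds}"]) auto
  show ?thesis unfolding koszul_sign_def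
    by (rule prod.mono_neutral_cong_left[OF fin]) (auto split: if_splits)
qed

text \<open>
  The composite puts a pair of letters out of order iff exactly one of the two permutations does so, and
  a factor that both of them contribute squares to one.
\<close>

lemma koszul_sign_compose:
  assumes \<sigma>: "\<sigma> permutes {..<length ds}" and \<tau>: "\<tau> permutes {..<length ds}"
  shows "koszul_sign ds (\<sigma> \<circ> \<tau>) =
    (koszul_sign ds \<sigma> * koszul_sign (permute_list \<sigma> ds) \<tau> :: 'k::field_char_0)"
proof -
  let ?n = "length ds" and ?e = "\<lambda>a b. (-1 :: 'k) powi (ds ! \<sigma> a * ds ! \<sigma> b)"
  let ?P = "{(i, j). i < j \<and> j < ?n}"
  let ?i = "inv \<tau>"
  have lt: "\<tau> i < ?n \<longleftrightarrow> i < ?n" "?i i < ?n \<longleftrightarrow> i < ?n" for i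
    using permutes_in_image[OF \<tau>, of i] permutes_in_image[OF permutes_inv[OF \<tau>], of i] by auto
  have inv: "\<tau> (?i i) = i" "?i (\<tau> i) = i" for i
    using permutes_inverses[OF \<tau>] by auto
  have inj: "\<tau> i = \<tau> j \<longleftrightarrow> i = j" "?i i = ?i j \<longleftrightarrow> i = j" "\<sigma> i = \<sigma> j \<longleftrightarrow> i = j" for i j
    using inv permutes_inj[OF \<sigma>] by (metis, metis, metis injD)
  have "koszul_sign ds \<sigma> = (\<Prod>(i, j) \<in> ?P. if \<sigma> j < \<sigma> i then ?e i j else 1)"
    by (simp add: koszul_sign_pairs)
  \<comment> \<open>reindex the unordered pairs of positions by \<open>\<tau>\<close>\<close>
  also have "\<dots> = (\<Prod>(i, j) \<in> ?P. if (\<tau> i < \<tau> j) = (\<sigma> (\<tau> j) < \<sigma> (\<tau> i)) then ?e (\<tau> i) (\<tau> j) else 1)"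
  proof (rule prod.reindex_bij_witness[of _ "\<lambda>(i, j). (min (\<tau> i) (\<tau> j), max (\<tau> i) (\<tau> j))"
          "\<lambda>(i, j). (min (?i i) (?i j), max (?i i) (?i j))"])
    fix p assume p: "p \<in> ?P"
    obtain i j where ij: "p = (i, j)" "i < j" "j < ?n" using p by auto
    have ne: "?i i \<noteq> ?i j" "\<tau> i \<noteq> \<tau> j" using ij inj by auto
    show "(case case p of (i, j) \<Rightarrow> (min (?i i) (?i j), max (?i i) (?i j)) of
       (i, j) \<Rightarrow> (min (\<tau> i) (\<tau> j), max (\<tau> i) (\<tau> j))) = p"
      using ij by (cases "?i i < ?i j") (auto simp: min_def max_def inv)
    show "(case p of (i, j) \<Rightarrow> (min (?i i) (?i j), max (?i i) (?i j))) \<in> ?P"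
      using ij ne lt by (cases "?i i < ?i j") (auto simp: min_def max_def)
    show "(case case p of (i, j) \<Rightarrow> (min (\<tau> i) (\<tau> j), max (\<tau> i) (\<tau> j)) of
       (i, j) \<Rightarrow> (min (?i i) (?i j), max (?i i) (?i j))) = p"
      using ij by (cases "\<tau> i < \<tau> j") (auto simp: min_def max_def inv)
    show "(case p of (i, j) \<Rightarrow> (min (\<tau> i) (\<tau> j), max (\<tau> i) (\<tau> j))) \<in> ?P"
      using ij ne lt by (cases "\<tau> i < \<tau> j") (auto simp: min_def max_def)
    have "\<sigma> i \<noteq> \<sigma> j" using ij inj by auto
    then show "(case case p of (i, j) \<Rightarrow> (min (?i i) (?i j), max (?i i) (?i j)) of
       (i, j) \<Rightarrow> if (\<tau> i < \<tau> j) = (\<sigma> (\<tau> j) < \<sigma> (\<tau> i)) then ?e (\<tau> i) (\<tau> j) else 1) =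
       (case p of (i, j) \<Rightarrow> if \<sigma> j < \<sigma> i then ?e i j else 1)"
      using ij ne by (cases "?i i < ?i j") (auto simp: min_def max_def inv mult.commute)
  qed
  finally have 1: "koszul_sign ds \<sigma> = \<dots>" .
  have 2: "(koszul_sign (permute_list \<sigma> ds) \<tau> :: 'k) =
     (\<Prod>(i, j) \<in> ?P. if \<tau> j < \<tau> i then ?e (\<tau> i) (\<tau> j) else 1)"
    unfolding koszul_sign_pairs length_permute_list
    by (rule prod.cong) (auto simp: permute_list_nth[OF \<sigma>] lt)
  show ?thesis
    unfolding 1 2 prod.distrib[symmetric] unfolding koszul_sign_pairs
  proof (rule prod.cong)
    fix p assume "p \<in> ?P"
    then obtain i j where ij: "p = (i, j)" "i < j" "j < ?n" by auto
    have ne: "\<tau> i \<noteq> \<tau> j" "\<sigma> (\<tau> i) \<noteq> \<sigma> (\<tau> j)" using ij inj by auto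
    have "?e (\<tau> i) (\<tau> j) * ?e (\<tau> i) (\<tau> j) = 1" by (simp add: sign_powi)
    then show "(case p of (i, j) \<Rightarrow> if (\<sigma> \<circ> \<tau>) j < (\<sigma> \<circ> \<tau>) i
          then (- 1 :: 'k) powi (ds ! (\<sigma> \<circ> \<tau>) i * ds ! (\<sigma> \<circ> \<tau>) j) else 1) =
       (case p of (i, j) \<Rightarrow> if (\<tau> i < \<tau> j) = (\<sigma> (\<tau> j) < \<sigma> (\<tau> i)) then ?e (\<tau> i) (\<tau> j) else 1) *
       (case p of (i, j) \<Rightarrow> if \<tau> j < \<tau> i then ?e (\<tau> i) (\<tau> j) else 1)"
      unfolding ij(1) prod.case comp_def using ne by (auto simp: not_less_iff_gr_or_eq)
  qed simp
qed

text \<open>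
  The permutation that exchanges two adjacent blocks of lengths \<open>q\<close> and \<open>r\<close> after a prefix of length \<open>p\<close>.
  Since \<open>permute_list \<sigma> xs\<close> reads \<open>xs\<close> at \<open>\<sigma> i\<close>, the argument is a position in the rearranged list, where
  the block of length \<open>r\<close> comes first.
\<close>

definition swap_blocks :: "nat \<Rightarrow> nat \<Rightarrow> nat \<Rightarrow> nat \<Rightarrow> nat" where
  "swap_blocks p q r i =
     (if i < p then i else if i < p + r then i + q else if i < p + q + r then i - r else i)"

lemma swap_blocks_permutes:
  assumes "p + q + r \<le> n"
  shows "swap_blocks p q r permutes {..<n}"
proof (rule bij_imp_permutes)
  show "bij_betw (swap_blocks p q r) {..<n} {..<n}"
    by (rule bij_betw_byWitness[where f' = "swap_blocks p r q"])
      (use assms in \<open>auto simp: swap_blocks_def\<close>)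
qed (use assms in \<open>auto simp: swap_blocks_def\<close>)

lemma permute_swap_blocks:
  "permute_list (swap_blocks (length u) (length a) (length b)) (u @ a @ b @ v) = u @ b @ a @ v"
proof (rule nth_equalityI)
  fix i assume "i < length (permute_list (swap_blocks (length u) (length a) (length b)) (u @ a @ b @ v))"
  then have i: "i < length u + length a + length b + length v" by simp
  let ?s = "swap_blocks (length u) (length a) (length b)"
  have eq: "permute_list ?s (u @ a @ b @ v) ! i = (u @ a @ b @ v) ! ?s i"
    using i by (simp add: permute_list_nth swap_blocks_permutes)
  consider "i < length u" | k where "i = length u + k" "k < length b"
    | k where "i = length u + (length b + k)" "k < length a"
    | k where "i = length u + (length b + (length a + k))"
    using i by (metis add.assoc add_less_cancel_left le_iff_add not_less)
  then show "permute_list ?s (u @ a @ b @ v) ! i = (u @ b @ a @ v) ! i"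
  proof cases
    case 1
    then show ?thesis by (simp add: eq swap_blocks_def nth_append)
  next
    case (2 k)
    then have "?s i = length u + (length a + k)" by (simp add: swap_blocks_def)
    with 2 show ?thesis unfolding eq by (simp add: nth_append_length_plus nth_append_left)
  next
    case (3 k)
    then have "?s i = length u + k" by (simp add: swap_blocks_def)
    with 3 show ?thesis unfolding eq by (simp add: nth_append_length_plus nth_append_left)
  next
    case (4 k)
    then have "?s i = length u + (length a + (length b + k))" by (simp add: swap_blocks_def)
    with 4 show ?thesis unfolding eq by (simp add: nth_append_length_plus)
  qed
qed simp

text \<open>
  The pairs out of order are exactly those with one letter in each block, so the exponents add up to the
  product of the two block degrees.
\<close>

lemma koszul_sign_swap_blocks:
  "koszul_sign (u @ a @ b @ v) (swap_blocks (length u) (length a) (length b)) =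
    ((-1) powi (sum_list a * sum_list b) :: 'k::field_char_0)"
proof -
  let ?p = "length u" and ?q = "length a" and ?r = "length b" and ?ds = "u @ a @ b @ v"
  let ?s = "swap_blocks ?p ?q ?r"
  have inversions: "{(i, j). i < j \<and> j < length ?ds \<and> ?s j < ?s i} =
      {?p..<?p + ?r} \<times> {?p + ?r..<?p + ?q + ?r}"
    by (auto simp: swap_blocks_def split: if_splits)
  have "(koszul_sign ?ds ?s :: 'k) =
      (\<Prod>(i, j) \<in> {..<?r} \<times> {..<?q}. (-1) powi (b ! i * a ! j))"
    unfolding koszul_sign_def inversions
  proof (rule prod.reindex_bij_witness[of _ "\<lambda>(i, j). (?p + i, ?p + ?r + j)"
          "\<lambda>(i, j). (i - ?p, j - ?p - ?r)"], goal_cases)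
    case (5 x)
    then obtain i j where x: "x = (?p + i, ?p + ?r + j)" and lt: "i < ?r" "j < ?q"
      by (auto dest!: le_Suc_ex)
    then have s: "?s (?p + i) = ?p + (?q + i)" "?s (?p + ?r + j) = ?p + j"
      by (simp_all add: swap_blocks_def)
    have "?ds ! (?p + (?q + i)) = b ! i" "?ds ! (?p + j) = a ! j"
      using lt by (simp_all only: nth_append_length_plus nth_append_left)
    then show ?case by (simp add: x s)
  qed auto
  also have "\<dots> = (\<Prod>i<?r. \<Prod>j<?q. (-1) powi (b ! i * a ! j))"
    by (simp add: prod.cartesian_product)
  also have "\<dots> = (-1) powi (\<Sum>i<?r. \<Sum>j<?q. b ! i * a ! j)"
    by (simp add: sign_sum)
  also have "(\<Sum>i<?r. \<Sum>j<?q. b ! i * a ! j) = sum_list a * sum_list b"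
    by (simp add: sum_list_sum_nth atLeast0LessThan sum_product mult.commute sum.swap[of _ "{..<?q}"])
  finally show ?thesis .
qed

text \<open>
  The action of \<open>\<tau>\<close> on the tail of a list, after the first \<open>s\<close> positions.
\<close>

definition shift_perm :: "nat \<Rightarrow> (nat \<Rightarrow> nat) \<Rightarrow> nat \<Rightarrow> nat" where
  "shift_perm s \<tau> k = (if k < s then k else s + \<tau> (k - s))"

lemma shift_perm_permutes:
  assumes "\<tau> permutes {..<m}"
  shows "shift_perm s \<tau> permutes {s..<s + m}"
proof (rule bij_imp_permutes)
  have lt: "\<tau> i < m \<longleftrightarrow> i < m" "inv \<tau> i < m \<longleftrightarrow> i < m" for i
    using permutes_in_image[OF assms, of i] permutes_in_image[OF permutes_inv[OF assms], of i] by auto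
  show "bij_betw (shift_perm s \<tau>) {s..<s + m} {s..<s + m}"
    by (rule bij_betw_byWitness[where f' = "shift_perm s (inv \<tau>)"])
      (auto simp: shift_perm_def permutes_inverses[OF assms] less_diff_conv2 lt)
  show "shift_perm s \<tau> x = x" if "x \<notin> {s..<s + m}" for x
    using that permutes_not_in[OF assms, of "x - s"] by (auto simp: shift_perm_def)
qed

lemma permute_shift_perm:
  assumes "\<tau> permutes {..<length v}"
  shows "permute_list (shift_perm (length u) \<tau>) (u @ v) = u @ permute_list \<tau> v"
proof (rule nth_equalityI)
  fix i assume "i < length (permute_list (shift_perm (length u) \<tau>) (u @ v))"
  then have "i < length u + length v" by simp
  then have "permute_list (shift_perm (length u) \<tau>) (u @ v) ! i = (u @ v) ! shift_perm (length u) \<tau> i"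
    by (simp add: permute_list_def)
  then show "permute_list (shift_perm (length u) \<tau>) (u @ v) ! i = (u @ permute_list \<tau> v) ! i"
    using \<open>i < length u + length v\<close>
    by (cases "i < length u") (simp_all add: shift_perm_def nth_append permute_list_nth[OF assms])
qed simp

lemma koszul_sign_shift_perm:
  assumes "\<tau> permutes {..<length v}"
  shows "koszul_sign (u @ v) (shift_perm (length u) \<tau>) = (koszul_sign v \<tau> :: 'k::field_char_0)"
proof -
  let ?s = "shift_perm (length u) \<tau>"
  have s: "?s (length u + i) = length u + \<tau> i" for i by (simp add: shift_perm_def)
  have ge: "length u \<le> i" if "i < j" "?s j < ?s i" for i j
    using that by (auto simp: shift_perm_def split: if_splits)
  show ?thesis
    unfolding koszul_sign_def
  proof (rule prod.reindex_bij_witness[of _ "\<lambda>(i, j). (length u + i, length u + j)"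
        "\<lambda>(i, j). (i - length u, j - length u)"])
    fix x assume "x \<in> {(i, j). i < j \<and> j < length (u @ v) \<and> ?s j < ?s i}"
    then obtain i j where x: "x = (i, j)" "i < j" "j < length (u @ v)" "?s j < ?s i" by auto
    then obtain i' j' where ij: "i = length u + i'" "j = length u + j'"
      using ge[OF x(2,4)] by (metis le_Suc_ex less_imp_le order_trans)
    show "(case case x of (i, j) \<Rightarrow> (i - length u, j - length u) of (i, j) \<Rightarrow> (length u + i, length u + j)) = x"
      "(case x of (i, j) \<Rightarrow> (i - length u, j - length u)) \<in> {(i, j). i < j \<and> j < length v \<and> \<tau> j < \<tau> i}"
      "(case case x of (i, j) \<Rightarrow> (i - length u, j - length u) of (i, j) \<Rightarrow> (-1 :: 'k) powi (v ! \<tau> i * v ! \<tau> j)) =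
        (case x of (i, j) \<Rightarrow> (-1) powi ((u @ v) ! ?s i * (u @ v) ! ?s j))"
      using x by (simp_all add: ij s)
  qed (auto simp: s)
qed

lemma permute_append:
  assumes "\<tau> permutes {..<length u}"
  shows "permute_list \<tau> (u @ v) = permute_list \<tau> u @ v"
proof (rule nth_equalityI)
  fix i assume "i < length (permute_list \<tau> (u @ v))"
  then have "permute_list \<tau> (u @ v) ! i = (u @ v) ! \<tau> i"
    by (simp add: permute_list_def)
  then show "permute_list \<tau> (u @ v) ! i = (permute_list \<tau> u @ v) ! i"
    using permutes_in_image[OF assms, of i] permutes_not_in[OF assms, of i]
    by (cases "i < length u") (simp_all add: nth_append permute_list_nth[OF assms])
qed simp

lemma koszul_sign_append:
  assumes "\<tau> permutes {..<length u}"
  shows "koszul_sign (u @ v) \<tau> = (koszul_sign u \<tau> :: 'k::field_char_0)"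
proof -
  have lt: "\<tau> i < length u \<longleftrightarrow> i < length u" for i using permutes_in_image[OF assms, of i] by auto
  have "j < length u" if "i < j" "\<tau> j < \<tau> i" for i j
  proof (rule ccontr)
    assume "\<not> j < length u"
    then have "\<tau> j = j" using permutes_not_in[OF assms, of j] by simp
    then show False using that lt[of i] permutes_not_in[OF assms, of i] \<open>\<not> j < length u\<close>
      by (cases "i < length u") auto
  qed
  then have inversions: "{(i, j). i < j \<and> j < length (u @ v) \<and> \<tau> j < \<tau> i} =
      {(i, j). i < j \<and> j < length u \<and> \<tau> j < \<tau> i}"
    by (auto intro: trans_less_add1)
  show ?thesis unfolding koszul_sign_def inversions
    by (rule prod.cong) (auto simp: nth_append lt)
qed

lemma permutes_fix_zeroE:
  assumes "\<rho> permutes {..<Suc m}" "\<rho> 0 = 0"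
  obtains \<tau> where "\<tau> permutes {..<m}" "\<rho> = shift_perm 1 \<tau>"
proof
  let ?\<tau> = "\<lambda>k. \<rho> (Suc k) - 1"
  have inj: "\<rho> i = \<rho> j \<longleftrightarrow> i = j" for i j using permutes_inj[OF assms(1)] by (metis injD)
  have pos: "\<rho> (Suc k) > 0" for k using inj[of "Suc k" 0] assms(2) by simp
  show "?\<tau> permutes {..<m}"
  proof (rule bij_imp_permutes)
    have "inj_on ?\<tau> {..<m}"
    proof (rule inj_onI)
      fix i j assume "\<rho> (Suc i) - 1 = \<rho> (Suc j) - 1"
      then have "\<rho> (Suc i) = \<rho> (Suc j)" using pos[of i] pos[of j] by linarith
      then show "i = j" using inj by simp
    qed
    moreover have "?\<tau> ` {..<m} \<subseteq> {..<m}"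
    proof clarsimp
      fix i assume "i < m"
      then show "\<rho> (Suc i) - Suc 0 < m"
        using permutes_in_image[OF assms(1), of "Suc i"] pos[of i] by simp
    qed
    ultimately show "bij_betw ?\<tau> {..<m} {..<m}"
      by (simp add: bij_betw_def endo_inj_surj)
    show "?\<tau> x = x" if "x \<notin> {..<m}" for x
      using permutes_not_in[OF assms(1), of "Suc x"] that by simp
  qed
  show "\<rho> = shift_perm 1 ?\<tau>"
  proof
    fix k show "\<rho> k = shift_perm 1 ?\<tau> k"
      using assms(2) pos[of "k - 1"] by (cases k) (auto simp: shift_perm_def)
  qed
qed

section \<open>Unshuffles as coset representatives\<close>

lemma unshuffles_two_iff:
  "\<sigma> \<in> unshuffles [p, q] \<longleftrightarrow> \<sigma> permutes {..<p + q} \<and>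
     (\<forall>i. Suc i < p + q \<longrightarrow> Suc i \<noteq> p \<longrightarrow> \<sigma> i < \<sigma> (Suc i))"
proof -
  have "{sum_list (take k [p, q]) | k. k \<le> length [p, q]} = {0, p, p + q}"
  proof (intro equalityI subsetI)
    fix x assume "x \<in> {sum_list (take k [p, q]) | k. k \<le> length [p, q]}"
    then obtain k where "x = sum_list (take k [p, q])" "k \<le> 2" by auto
    moreover from this have "k = 0 \<or> k = 1 \<or> k = 2" by auto
    ultimately show "x \<in> {0, p, p + q}" by auto
  next
    fix x assume "x \<in> {0, p, p + q}"
    then have "x = sum_list (take (if x = 0 then 0 else if x = p then 1 else 2) [p, q])" by auto
    then show "x \<in> {sum_list (take k [p, q]) | k. k \<le> length [p, q]}"
      by (intro CollectI exI[of _ "if x = 0 then 0 else if x = p then 1 else 2"]) simp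
  qed
  then show ?thesis unfolding unshuffles_def by auto
qed

lemma unshuffle_permutes: "\<sigma> \<in> unshuffles [p, q] \<Longrightarrow> p + q = n \<Longrightarrow> \<sigma> permutes {..<n}"
  by (auto simp: unshuffles_two_iff)

lemma finite_unshuffles_two: "finite (unshuffles [p, q])"
  by (rule finite_subset[OF _ finite_permutations[of "{..<p + q}"]])
    (auto simp: unshuffles_two_iff)

lemma id_unshuffle: "id \<in> unshuffles [p, q]"
  by (simp add: unshuffles_two_iff permutes_id)

text \<open>
  An unshuffle enumerates the image of its first block and the complement of that image in increasing
  order; hence this image determines it.
\<close>

lemma unshuffle_block_lists:
  assumes "\<sigma> \<in> unshuffles [p, q]"
  shows "map \<sigma> [0..<p] = sorted_list_of_set (\<sigma> ` {..<p})"
    and "map \<sigma> [p..<p + q] = sorted_list_of_set ({..<p + q} - \<sigma> ` {..<p})"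
proof -
  have \<sigma>: "\<sigma> permutes {..<p + q}"
    and mono: "\<And>i. Suc i < p + q \<Longrightarrow> Suc i \<noteq> p \<Longrightarrow> \<sigma> i < \<sigma> (Suc i)"
    using assms by (auto simp: unshuffles_two_iff)
  have inj: "inj_on \<sigma> X" for X using permutes_inj_on[OF \<sigma>] .
  have "sorted (map \<sigma> [0..<p])" "sorted (map \<sigma> [p..<p + q])"
    by (auto simp: sorted_iff_nth_Suc intro!: less_imp_le mono)
  moreover have "\<sigma> ` {p..<p + q} = {..<p + q} - \<sigma> ` {..<p}"
  proof -
    have block: "{p..<p + q} = {..<p + q} - {..<p}" by auto
    show ?thesis unfolding block image_set_diff[OF permutes_inj[OF \<sigma>]] permutes_image[OF \<sigma>] ..
  qed
  ultimately show "map \<sigma> [0..<p] = sorted_list_of_set (\<sigma> ` {..<p})"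
    "map \<sigma> [p..<p + q] = sorted_list_of_set ({..<p + q} - \<sigma> ` {..<p})"
    using inj by (auto intro!: sorted_distinct_set_unique simp: distinct_map atLeast0LessThan simp del: map_map)
qed

lemma block_permutation_eq:
  fixes p q :: nat
  assumes "\<alpha> permutes {..<p}" "\<beta> permutes {p..<p + q}" "i < p + q"
  shows "(\<alpha> \<circ> \<beta>) i = (if i < p then \<alpha> i else \<beta> i)"
proof (cases "i < p")
  case True
  then show ?thesis using permutes_not_in[OF assms(2), of i] by simp
next
  case False
  then have "\<beta> i \<in> {p..<p + q}" using permutes_in_image[OF assms(2), of i] assms(3) by simp
  then have "\<alpha> (\<beta> i) = \<beta> i" using permutes_not_in[OF assms(1), of "\<beta> i"] by simp
  with False show ?thesis by simp
qed

text \<open>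
  Unshuffles form a system of representatives for the cosets of the group of permutations that preserve
  the two blocks.
\<close>

lemma unshuffle_decomposition:
  "bij_betw (\<lambda>(\<sigma>, \<alpha>, \<beta>). \<sigma> \<circ> (\<alpha> \<circ> \<beta>))
     (unshuffles [p, q] \<times> {\<alpha>. \<alpha> permutes {..<p}} \<times> {\<beta>. \<beta> permutes {p..<p + q}})
     {\<rho>. \<rho> permutes {..<p + q}}"
proof -
  let ?n = "p + q"
  have blocks: "(\<alpha> \<circ> \<beta>) permutes {..<?n}" "(\<alpha> \<circ> \<beta>) ` {..<p} = {..<p}"
    if "\<alpha> permutes {..<p}" "\<beta> permutes {p..<?n}" for \<alpha> \<beta>
  proof -
    have "\<alpha> permutes {..<?n}" "\<beta> permutes {..<?n}"
      by (auto intro: permutes_subset[OF that(1)] permutes_subset[OF that(2)])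
    then show "(\<alpha> \<circ> \<beta>) permutes {..<?n}" by (rule permutes_compose[rotated])
    have "(\<alpha> \<circ> \<beta>) ` {..<p} = \<alpha> ` {..<p}"
      by (rule image_cong) (use block_permutation_eq[OF that] in auto)
    then show "(\<alpha> \<circ> \<beta>) ` {..<p} = {..<p}" using permutes_image[OF that(1)] by simp
  qed
  show ?thesis
  proof (rule bij_betw_imageI)
    show "inj_on (\<lambda>(\<sigma>, \<alpha>, \<beta>). \<sigma> \<circ> (\<alpha> \<circ> \<beta>))
        (unshuffles [p, q] \<times> {\<alpha>. \<alpha> permutes {..<p}} \<times> {\<beta>. \<beta> permutes {p..<?n}})"
    proof (rule inj_onI)
      fix x y assume xy: "x \<in> unshuffles [p, q] \<times> {\<alpha>. \<alpha> permutes {..<p}} \<times> {\<beta>. \<beta> permutes {p..<?n}}"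
        "y \<in> unshuffles [p, q] \<times> {\<alpha>. \<alpha> permutes {..<p}} \<times> {\<beta>. \<beta> permutes {p..<?n}}"
        "(case x of (\<sigma>, \<alpha>, \<beta>) \<Rightarrow> \<sigma> \<circ> (\<alpha> \<circ> \<beta>)) = (case y of (\<sigma>, \<alpha>, \<beta>) \<Rightarrow> \<sigma> \<circ> (\<alpha> \<circ> \<beta>))"
      obtain \<sigma> \<alpha> \<beta> \<sigma>' \<alpha>' \<beta>' where x: "x = (\<sigma>, \<alpha>, \<beta>)" and y: "y = (\<sigma>', \<alpha>', \<beta>')"
        by (metis prod_cases3)
      have \<sigma>: "\<sigma> \<in> unshuffles [p, q]" "\<sigma>' \<in> unshuffles [p, q]"
        and \<alpha>: "\<alpha> permutes {..<p}" "\<alpha>' permutes {..<p}"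
        and \<beta>: "\<beta> permutes {p..<?n}" "\<beta>' permutes {p..<?n}"
        and eq: "\<sigma> \<circ> (\<alpha> \<circ> \<beta>) = \<sigma>' \<circ> (\<alpha>' \<circ> \<beta>')"
        using xy unfolding x y prod.case by blast+
      have "\<sigma> ` {..<p} = (\<sigma> \<circ> (\<alpha> \<circ> \<beta>)) ` {..<p}"
        using blocks(2)[OF \<alpha>(1) \<beta>(1)] by (simp add: image_comp[symmetric] del: comp_apply)
      also have "\<dots> = \<sigma>' ` {..<p}"
        unfolding eq using blocks(2)[OF \<alpha>(2) \<beta>(2)] by (simp add: image_comp[symmetric] del: comp_apply)
      finally have im: "\<sigma> ` {..<p} = \<sigma>' ` {..<p}" .
      have "map \<sigma> [0..<p] = map \<sigma>' [0..<p]" "map \<sigma> [p..<?n] = map \<sigma>' [p..<?n]"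
        using unshuffle_block_lists[OF \<sigma>(1)] unshuffle_block_lists[OF \<sigma>(2)] im by auto
      then have "\<sigma> i = \<sigma>' i" if "i < ?n" for i
        using that by (cases "i < p") (auto simp: map_eq_conv)
      moreover have "\<sigma> i = \<sigma>' i" if "\<not> i < ?n" for i
        using \<sigma> that permutes_not_in by (metis lessThan_iff unshuffles_two_iff)
      ultimately have s: "\<sigma> = \<sigma>'" by blast
      have "inj \<sigma>" using \<sigma>(1) permutes_inj by (auto simp: unshuffles_two_iff)
      then have ab: "\<alpha> \<circ> \<beta> = \<alpha>' \<circ> \<beta>'"
        using eq unfolding s by (metis fun.inj_map_strong inj_eq)
      have "\<alpha> i = \<alpha>' i" for i
      proof (cases "i < p")
        case True
        then show ?thesis
          using block_permutation_eq[OF \<alpha>(1) \<beta>(1), of i] block_permutation_eq[OF \<alpha>(2) \<beta>(2), of i] ab by auto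
      qed (use permutes_not_in[OF \<alpha>(1), of i] permutes_not_in[OF \<alpha>(2), of i] in auto)
      moreover have "\<beta> i = \<beta>' i" for i
      proof (cases "p \<le> i \<and> i < ?n")
        case True
        then show ?thesis
          using block_permutation_eq[OF \<alpha>(1) \<beta>(1), of i] block_permutation_eq[OF \<alpha>(2) \<beta>(2), of i] ab by auto
      qed (use permutes_not_in[OF \<beta>(1), of i] permutes_not_in[OF \<beta>(2), of i] in auto)
      ultimately show "x = y" using s unfolding x y by blast
    qed
    show "(\<lambda>(\<sigma>, \<alpha>, \<beta>). \<sigma> \<circ> (\<alpha> \<circ> \<beta>)) `
        (unshuffles [p, q] \<times> {\<alpha>. \<alpha> permutes {..<p}} \<times> {\<beta>. \<beta> permutes {p..<?n}}) =
        {\<rho>. \<rho> permutes {..<?n}}" (is "?f ` ?X = ?Y")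
    proof (intro equalityI subsetI)
      fix \<rho> assume "\<rho> \<in> ?f ` ?X"
      then show "\<rho> \<in> ?Y"
        using blocks(1) by (auto simp: unshuffles_two_iff intro: permutes_compose)
    next
      fix \<rho> assume "\<rho> \<in> ?Y"
      then have \<rho>: "\<rho> permutes {..<?n}" by simp
      \<comment> \<open>the representative of \<open>\<rho>\<close> lists the image of the first block, then the complement\<close>
      let ?S = "\<rho> ` {..<p}"
      let ?l = "sorted_list_of_set ?S" and ?r = "sorted_list_of_set ({..<?n} - ?S)"
      have sub: "?S \<subseteq> {..<?n}" using permutes_image[OF \<rho>] by fastforce
      have card: "card ?S = p" using card_image[OF permutes_inj_on[OF \<rho>], of "{..<p}"] by simp
      have len: "length ?l = p" "length ?r = q"
        using sub card by (simp_all add: card_Diff_subset finite_subset)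
      have set: "set ?l = ?S" "set ?r = {..<?n} - ?S" by auto
      define \<sigma> where "\<sigma> i = (if i < ?n then (?l @ ?r) ! i else i)" for i
      have dist: "distinct (?l @ ?r)" by simp
      have setn: "set (?l @ ?r) = {..<?n}" using sub by auto
      have \<sigma>: "\<sigma> permutes {..<?n}"
      proof (rule bij_imp_permutes)
        have "bij_betw ((!) (?l @ ?r)) {..<?n} {..<?n}"
          using bij_betw_nth[OF dist, of "{..<?n}" "{..<?n}"] setn len by simp
        then show "bij_betw \<sigma> {..<?n} {..<?n}"
          by (subst bij_betw_cong[of _ _ "(!) (?l @ ?r)"]) (auto simp: \<sigma>_def)
      qed (simp add: \<sigma>_def)
      have un: "\<sigma> \<in> unshuffles [p, q]"
        unfolding unshuffles_two_iff
      proof (intro conjI allI impI \<sigma>)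
        fix i assume i: "Suc i < ?n" "Suc i \<noteq> p"
        show "\<sigma> i < \<sigma> (Suc i)"
        proof (cases "Suc i < p")
          case True
          then show ?thesis using i len sorted_wrt_nth_less[OF strict_sorted_list_of_set, of i "Suc i" ?S]
            by (simp add: \<sigma>_def nth_append)
        next
          case False
          then have "p \<le> i" using i by simp
          then show ?thesis using i len
              sorted_wrt_nth_less[OF strict_sorted_list_of_set, of "i - p" "Suc i - p" "{..<?n} - ?S"]
            by (simp add: \<sigma>_def nth_append Suc_diff_le)
        qed
      qed
      define \<tau> where "\<tau> = inv \<sigma> \<circ> \<rho>"
      have \<tau>: "\<tau> permutes {..<?n}" unfolding \<tau>_def
        by (rule permutes_compose[OF \<rho> permutes_inv[OF \<sigma>]])
      have "\<sigma> ` {..<p} = (!) ?l ` {..<p}"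
        by (rule image_cong) (auto simp: \<sigma>_def nth_append card)
      also have "\<dots> = ?S" using nth_image[of p ?l] len set by (simp add: lessThan_atLeast0)
      finally have "inv \<sigma> ` ?S = {..<p}"
        by (metis \<sigma> image_inv_f_f permutes_inj)
      then have im: "\<tau> ` {..<p} = {..<p}" by (simp add: \<tau>_def image_comp[symmetric] del: comp_apply)
      have block: "{p..<?n} = {..<?n} - {..<p}" by auto
      have im2: "\<tau> ` {p..<?n} = {p..<?n}"
        unfolding block image_set_diff[OF permutes_inj[OF \<tau>]] permutes_image[OF \<tau>] im ..
      let ?\<alpha> = "\<lambda>i. if i < p then \<tau> i else i" and ?\<beta> = "\<lambda>i. if p \<le> i then \<tau> i else i"
      have \<alpha>: "?\<alpha> permutes {..<p}"
      proof (rule bij_imp_permutes)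
        have "bij_betw \<tau> {..<p} {..<p}" using im permutes_inj_on[OF \<tau>] by (simp add: bij_betw_def)
        then show "bij_betw ?\<alpha> {..<p} {..<p}"
          by (subst bij_betw_cong[of _ _ \<tau>]) auto
      qed simp
      have \<beta>: "?\<beta> permutes {p..<?n}"
      proof (rule bij_imp_permutes)
        have "bij_betw \<tau> {p..<?n} {p..<?n}" using im2 permutes_inj_on[OF \<tau>] by (simp add: bij_betw_def)
        then show "bij_betw ?\<beta> {p..<?n} {p..<?n}"
          by (subst bij_betw_cong[of _ _ \<tau>]) auto
      qed (use permutes_not_in[OF \<tau>] in auto)
      have "?\<alpha> \<circ> ?\<beta> = \<tau>"
      proof
        fix i show "(?\<alpha> \<circ> ?\<beta>) i = \<tau> i"
          using block_permutation_eq[OF \<alpha> \<beta>, of i] permutes_not_in[OF \<tau>, of i] by (cases "i < ?n") auto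
      qed
      then have "\<rho> = \<sigma> \<circ> (?\<alpha> \<circ> ?\<beta>)"
        using permutes_inv_o(1)[OF \<sigma>] by (simp add: \<tau>_def o_assoc)
      then have "\<rho> = ?f (\<sigma>, ?\<alpha>, ?\<beta>)" by simp
      then show "\<rho> \<in> ?f ` ?X" using un \<alpha> \<beta> by blast
    qed
  qed
qed

section \<open>Symmetrization of functions of homogeneous words\<close>

definition word_degree :: "(int \<times> 'a) list \<Rightarrow> int" where
  "word_degree z = sum_list (map fst z)"

lemma word_degree_simps [simp]:
  "word_degree [] = 0" "word_degree (p # z) = fst p + word_degree z"
  "word_degree (y @ z) = word_degree y + word_degree z"
  by (simp_all add: word_degree_def)

context graded_vector_space begin

text \<open>
  Words carry the degree of each letter along with the letter. The degree of the zero vector is not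
  determined by the vector, so that it has to be remembered for the Koszul sign.
\<close>

definition words :: "nat \<Rightarrow> (int \<times> 'a) list set" where
  "words n = {z. length z = n \<and> (\<forall>(d, x) \<in> set z. x \<in> V d)}"

text \<open>
  The action of permutations on functions of words; a function is graded symmetric iff it is fixed by
  this action.
\<close>

definition koszul_act :: "((int \<times> 'a) list \<Rightarrow> 'a) \<Rightarrow> (nat \<Rightarrow> nat) \<Rightarrow> (int \<times> 'a) list \<Rightarrow> 'a" where
  "koszul_act f \<sigma> z = scale (koszul_sign (map fst z) \<sigma>) (f (permute_list \<sigma> z))"

definition symmetrization :: "nat \<Rightarrow> ((int \<times> 'a) list \<Rightarrow> 'a) \<Rightarrow> (int \<times> 'a) list \<Rightarrow> 'a" where
  "symmetrization n f z = (\<Sum>\<sigma> | \<sigma> permutes {..<n}. koszul_act f \<sigma> z)"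

lemma words_length: "z \<in> words n \<Longrightarrow> length z = n"
  by (simp add: words_def)

lemma words_permute:
  assumes "z \<in> words n" "\<sigma> permutes {..<n}"
  shows "permute_list \<sigma> z \<in> words n"
  using assms set_permute_list[of \<sigma> z] by (simp add: words_def)

lemma words_append: "y @ z \<in> words n \<longleftrightarrow> y \<in> words (length y) \<and> z \<in> words (length z) \<and> length y + length z = n"
  by (auto simp: words_def)

lemma words_Cons: "p # z \<in> words n \<longleftrightarrow> snd p \<in> V (fst p) \<and> z \<in> words (length z) \<and> Suc (length z) = n"
  by (auto simp: words_def)

lemma koszul_act_compose:
  assumes "z \<in> words n" "\<sigma> permutes {..<n}" "\<tau> permutes {..<n}"
  shows "koszul_act (koszul_act f \<tau>) \<sigma> z = koszul_act f (\<sigma> \<circ> \<tau>) z"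
  using assms
  by (simp add: koszul_act_def words_length permute_list_compose koszul_sign_compose permute_list_map[symmetric])

lemma koszul_act_cong:
  assumes "z \<in> words n" "\<sigma> permutes {..<n}" "\<And>y. y \<in> words n \<Longrightarrow> f y = g y"
  shows "koszul_act f \<sigma> z = koszul_act g \<sigma> z"
  using assms words_permute by (simp add: koszul_act_def)

lemma symmetrization_cong:
  assumes "z \<in> words n" "\<And>y. y \<in> words n \<Longrightarrow> f y = g y"
  shows "symmetrization n f z = symmetrization n g z"
  unfolding symmetrization_def using assms by (intro sum.cong koszul_act_cong) auto

text \<open>
  Under the symmetrization, the arguments may be rearranged as if they were equal elements of even degree.
\<close>

lemma symmetrization_koszul_act:
  assumes "z \<in> words n" "\<tau> permutes {..<n}"
  shows "symmetrization n (koszul_act f \<tau>) z = symmetrization n f z"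
proof -
  have "symmetrization n (koszul_act f \<tau>) z = (\<Sum>\<sigma> | \<sigma> permutes {..<n}. koszul_act f (\<sigma> \<circ> \<tau>) z)"
    unfolding symmetrization_def using assms by (intro sum.cong) (auto simp: koszul_act_compose)
  also have "\<dots> = symmetrization n f z"
    unfolding symmetrization_def by (rule sum_permutations_compose_right[OF assms(2), symmetric])
  finally show ?thesis .
qed

text \<open>
  A symmetrization is graded symmetric.
\<close>

lemma koszul_act_symmetrization:
  assumes "z \<in> words n" "\<tau> permutes {..<n}"
  shows "koszul_act (symmetrization n f) \<tau> z = symmetrization n f z"
proof -
  have "koszul_act (symmetrization n f) \<tau> z = (\<Sum>\<sigma> | \<sigma> permutes {..<n}. koszul_act (koszul_act f \<sigma>) \<tau> z)"
    by (simp add: koszul_act_def symmetrization_def scale_sum_right)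
  also have "\<dots> = (\<Sum>\<sigma> | \<sigma> permutes {..<n}. koszul_act f (\<tau> \<circ> \<sigma>) z)"
    using assms by (intro sum.cong) (auto simp: koszul_act_compose)
  also have "\<dots> = symmetrization n f z"
    unfolding symmetrization_def
    by (rule sum.reindex_bij_witness[of _ "\<lambda>\<rho>. inv \<tau> \<circ> \<rho>" "\<lambda>\<sigma>. \<tau> \<circ> \<sigma>"])
      (auto simp: o_assoc permutes_inv_o[OF assms(2)] intro!: permutes_compose permutes_inv assms)
  finally show ?thesis .
qed

lemma koszul_act_sum: "koszul_act (\<lambda>z. \<Sum>i\<in>I. f i z) \<sigma> z = (\<Sum>i\<in>I. koszul_act (f i) \<sigma> z)"
  by (simp add: koszul_act_def scale_sum_right)

lemma symmetrization_add:
  "symmetrization n (\<lambda>z. f z + g z) z = symmetrization n f z + symmetrization n g z"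
  by (simp add: symmetrization_def koszul_act_def scale_right_distrib sum.distrib)

lemma symmetrization_minus: "symmetrization n (\<lambda>z. - f z) z = - symmetrization n f z"
  by (simp add: symmetrization_def koszul_act_def sum_negf)

lemma symmetrization_sum:
  "symmetrization n (\<lambda>z. \<Sum>i\<in>I. f i z) z = (\<Sum>i\<in>I. symmetrization n (f i) z)"
  unfolding symmetrization_def koszul_act_sum by (rule sum.swap)

lemma eq_minus_self_imp_zero:
  fixes x :: 'a
  assumes "x = - x"
  shows "x = 0"
proof -
  have "scale (1 + 1) x = x + x" by (simp only: scale_left_distrib scale_one)
  also have "x + x = 0" using assms by (metis ab_left_minus)
  finally show ?thesis by simp
qed

lemma koszul_act_swap_blocks:
  "koszul_act f (swap_blocks (length u) (length a) (length b)) (u @ a @ b @ v) =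
     scale ((-1) powi (word_degree a * word_degree b)) (f (u @ b @ a @ v))"
  using koszul_sign_swap_blocks[where ?'k = 'k, of "map fst u" "map fst a" "map fst b" "map fst v"]
  by (simp add: koszul_act_def permute_swap_blocks word_degree_def)

lemma words_blocksE:
  assumes "z \<in> words n" "p + q + r \<le> n"
  obtains u a b v where "z = u @ a @ b @ v" "length u = p" "length a = q" "length b = r"
proof
  show "z = take p z @ take q (drop p z) @ take r (drop (p + q) z) @ drop (p + q + r) z"
    by (metis add.commute append_assoc append_take_drop_id drop_drop)
qed (use assms in \<open>auto simp: words_length\<close>)

text \<open>
  The form in which rearrangements are used: two expressions have the same symmetrization if they differ
  by the exchange of two adjacent blocks of arguments and by the Koszul sign of that exchange.
\<close>

lemma symmetrization_swap_blocks:
  assumes "z \<in> words n" "p + q + r \<le> n"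
    and swap: "\<And>u a b v. u @ a @ b @ v \<in> words n \<Longrightarrow> length u = p \<Longrightarrow> length a = q \<Longrightarrow> length b = r \<Longrightarrow>
      f (u @ a @ b @ v) = scale ((-1) powi (word_degree a * word_degree b)) (g (u @ b @ a @ v))"
  shows "symmetrization n f z = symmetrization n g z"
proof -
  have "f y = koszul_act g (swap_blocks p q r) y" if y: "y \<in> words n" for y
    using words_blocksE[OF y assms(2)] swap y by (metis koszul_act_swap_blocks)
  then have "symmetrization n f z = symmetrization n (koszul_act g (swap_blocks p q r)) z"
    by (rule symmetrization_cong[OF assms(1)])
  then show ?thesis
    using symmetrization_koszul_act[OF assms(1) swap_blocks_permutes[OF assms(2)]] by simp
qed

definition swap_invariant :: "nat \<Rightarrow> ((int \<times> 'a) list \<Rightarrow> 'a) \<Rightarrow> nat \<Rightarrow> bool" where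
  "swap_invariant n f k \<longleftrightarrow> (\<forall>u a b v. u @ [a, b] @ v \<in> words n \<longrightarrow> length u = k \<longrightarrow>
     f (u @ [a, b] @ v) = scale ((-1) powi (fst a * fst b)) (f (u @ [b, a] @ v)))"

lemma koszul_act_adjacent:
  assumes f: "swap_invariant n f k" and "Suc k < n" "z \<in> words n"
  shows "koszul_act f (transpose k (Suc k)) z = f z"
proof -
  have "transpose k (Suc k) = swap_blocks k 1 1"
    by (auto simp: fun_eq_iff swap_blocks_def transpose_def)
  moreover obtain u a b v where z: "z = u @ a @ b @ v" "length u = k" "length a = 1" "length b = 1"
    by (rule words_blocksE[OF assms(3), of k 1 1]) (use assms(2) in auto)
  moreover from z obtain a' b' where "a = [a']" "b = [b']"
    by (metis One_nat_def length_0_conv length_Suc_conv)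
  ultimately show ?thesis
    using f[unfolded swap_invariant_def, rule_format, of u a' b' v]
      koszul_act_swap_blocks[of f u a b v] assms(3) by simp
qed

text \<open>
  The permutations that fix \<open>f\<close> form a group, by \<open>koszul_act_compose\<close>, and adjacent transpositions
  generate all permutations of an interval. This allows graded symmetry of the iterated product to be
  checked on two neighbouring factors only.
\<close>

lemma koszul_act_invariant:
  assumes f: "\<And>k. a \<le> k \<Longrightarrow> Suc k < b \<Longrightarrow> swap_invariant n f k" and "b \<le> n"
    and \<tau>: "\<tau> permutes {a..<b}" and z: "z \<in> words n"
  shows "koszul_act f \<tau> z = f z"
proof -
  define G where "G = {\<tau>. \<tau> permutes {..<n} \<and> (\<forall>z\<in>words n. koszul_act f \<tau> z = f z)}"
  have comp: "\<sigma> \<circ> \<tau> \<in> G" if "\<sigma> \<in> G" "\<tau> \<in> G" for \<sigma> \<tau>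
  proof -
    have "koszul_act f (\<sigma> \<circ> \<tau>) y = f y" if "y \<in> words n" for y
    proof -
      have "koszul_act f (\<sigma> \<circ> \<tau>) y = koszul_act (koszul_act f \<tau>) \<sigma> y"
        using that \<open>\<sigma> \<in> G\<close> \<open>\<tau> \<in> G\<close> by (simp add: koszul_act_compose G_def)
      also have "\<dots> = koszul_act f \<sigma> y"
        using \<open>\<sigma> \<in> G\<close> \<open>\<tau> \<in> G\<close> by (intro koszul_act_cong[OF that]) (auto simp: G_def)
      finally show ?thesis using that \<open>\<sigma> \<in> G\<close> by (simp add: G_def)
    qed
    then show ?thesis using that by (auto simp: G_def intro: permutes_compose)
  qed
  have id_G: "id \<in> G" by (simp add: G_def permutes_id koszul_act_def koszul_sign_id)
  have adj: "transpose k (Suc k) \<in> G" if "a \<le> k" "Suc k < b" for k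
    using that \<open>b \<le> n\<close> koszul_act_adjacent[OF f[OF that]]
    by (auto simp: G_def intro!: permutes_swap_id)
  have step: "transpose i (Suc (i + d)) \<in> G" if "a \<le> i" "Suc (i + d) < b" for i d
    using that
  proof (induction d)
    case 0
    then show ?case using adj[of i] by simp
  next
    case (Suc d)
    let ?j = "Suc (i + d)"
    \<comment> \<open>conjugation with a neighbouring transposition enlarges the distance by one\<close>
    have "transpose i (Suc ?j) = transpose ?j (Suc ?j) \<circ> (transpose i ?j \<circ> transpose ?j (Suc ?j))"
      by (auto simp: fun_eq_iff transpose_def)
    moreover have "transpose ?j (Suc ?j) \<in> G" "transpose i ?j \<in> G"
      using Suc adj[of ?j] by auto
    ultimately show ?case using comp by (metis add_Suc_right)
  qed
  have tr: "transpose i j \<in> G" if "a \<le> i" "i < j" "j < b" for i j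
    using step[of i "j - Suc i"] that by simp
  have "\<tau> \<in> G" using finite_atLeastLessThan \<tau>
  proof (induction rule: permutes_rev_induct)
    case id
    show ?case by (rule id_G)
  next
    case (swap i j p)
    then have "transpose i j \<in> G"
      using tr[of i j] tr[of j i] by (cases i j rule: linorder_cases) (auto simp: transpose_commute)
    with swap show ?case by (blast intro: comp)
  qed
  then show ?thesis using z by (simp add: G_def)
qed

text \<open>
  Each permutation is an unshuffle followed by a permutation preserving the blocks, under which \<open>f\<close> is
  invariant; the factor counts the latter permutations.
\<close>

lemma symmetrization_unshuffles:
  assumes f: "\<And>k. Suc k < p + q \<Longrightarrow> Suc k \<noteq> p \<Longrightarrow> swap_invariant (p + q) f k"
    and z: "z \<in> words (p + q)"
  shows "symmetrization (p + q) f z = scale (fact p * fact q) (\<Sum>\<sigma>\<in>unshuffles [p, q]. koszul_act f \<sigma> z)"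
proof -
  let ?n = "p + q" and ?P = "{\<alpha>. \<alpha> permutes {..<p}}" and ?Q = "{\<beta>. \<beta> permutes {p..<p + q}}"
  have "symmetrization ?n f z =
      (\<Sum>(\<sigma>, \<alpha>, \<beta>) \<in> unshuffles [p, q] \<times> ?P \<times> ?Q. koszul_act f (\<sigma> \<circ> (\<alpha> \<circ> \<beta>)) z)"
    unfolding symmetrization_def sum.reindex_bij_betw[OF unshuffle_decomposition, symmetric]
    by (simp add: case_prod_unfold)
  also have "\<dots> = (\<Sum>(\<sigma>, \<alpha>\<beta>) \<in> unshuffles [p, q] \<times> (?P \<times> ?Q). koszul_act f \<sigma> z)"
  proof (rule sum.cong)
    fix x assume "x \<in> unshuffles [p, q] \<times> ?P \<times> ?Q"
    then obtain \<sigma> \<alpha> \<beta> where x: "x = (\<sigma>, \<alpha>, \<beta>)" "\<sigma> permutes {..<?n}"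
      "\<alpha> permutes {..<p}" "\<beta> permutes {p..<?n}" by (auto simp: unshuffles_two_iff)
    have perm: "\<alpha> permutes {..<?n}" "\<beta> permutes {..<?n}"
      by (auto intro: permutes_subset[OF x(3)] permutes_subset[OF x(4)])
    have inv: "koszul_act f \<alpha> y = f y" "koszul_act f \<beta> y = f y" if "y \<in> words ?n" for y
      using koszul_act_invariant[of 0 p ?n f \<alpha> y] koszul_act_invariant[of p ?n ?n f \<beta> y]
        f x(3,4) that by (auto simp: lessThan_atLeast0)
    have "koszul_act f (\<sigma> \<circ> (\<alpha> \<circ> \<beta>)) z = koszul_act (koszul_act (koszul_act f \<beta>) \<alpha>) \<sigma> z"
      using koszul_act_compose[OF z permutes_compose[OF perm(1) x(2)] perm(2), of f]
        koszul_act_compose[OF z x(2) perm(1), of "koszul_act f \<beta>"] by (simp add: o_assoc)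
    also have "\<dots> = koszul_act f \<sigma> z"
      using koszul_act_cong[OF _ perm(1) inv(2)] inv(1)
      by (intro koszul_act_cong[OF z x(2)]) simp
    finally show "(case x of (\<sigma>, \<alpha>, \<beta>) \<Rightarrow> koszul_act f (\<sigma> \<circ> (\<alpha> \<circ> \<beta>)) z) =
        (case x of (\<sigma>, \<alpha>\<beta>) \<Rightarrow> koszul_act f \<sigma> z)" by (simp add: x(1))
  qed simp
  also have "\<dots> = (\<Sum>\<sigma>\<in>unshuffles [p, q]. scale (of_nat (card (?P \<times> ?Q))) (koszul_act f \<sigma> z))"
    by (simp add: sum.cartesian_product[symmetric] sum_constant_scale)
  also have "card (?P \<times> ?Q) = fact p * fact q"
    by (simp add: card_cartesian_product card_permutations)
  finally show ?thesis by (simp add: scale_sum_right)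
qed

end

section \<open>Multilinear maps and homogeneous components\<close>

context graded_vector_space begin

abbreviation "tot \<equiv> total scale V"

lemma subspace_total: "subspace tot"
  unfolding total_def by (rule subspace_span)

lemma piece_total: "x \<in> V d \<Longrightarrow> x \<in> tot"
  unfolding total_def by (auto intro: span_base)

lemma multilinear_mapI:
  assumes "\<And>xs. length xs = n \<Longrightarrow> set xs \<subseteq> tot \<Longrightarrow> g xs \<in> tot"
    and "\<And>xs k a b. length xs = n \<Longrightarrow> set xs \<subseteq> tot \<Longrightarrow> k < n \<Longrightarrow> a \<in> tot \<Longrightarrow> b \<in> tot \<Longrightarrow>
      g (xs[k := a + b]) = g (xs[k := a]) + g (xs[k := b])"
    and "\<And>xs k a c. length xs = n \<Longrightarrow> set xs \<subseteq> tot \<Longrightarrow> k < n \<Longrightarrow> a \<in> tot \<Longrightarrow>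
      g (xs[k := scale c a]) = scale c (g (xs[k := a]))"
  shows "multilinear_map scale V n g"
  using assms unfolding multilinear_map_def by blast

lemma
  assumes "multilinear_map scale V n g" "length xs = n" "set xs \<subseteq> tot"
  shows multilinear_map_closed: "g xs \<in> tot"
    and multilinear_map_add: "k < n \<Longrightarrow> a \<in> tot \<Longrightarrow> b \<in> tot \<Longrightarrow> g (xs[k := a + b]) = g (xs[k := a]) + g (xs[k := b])"
    and multilinear_map_scale: "k < n \<Longrightarrow> a \<in> tot \<Longrightarrow> g (xs[k := scale c a]) = scale c (g (xs[k := a]))"
  using assms unfolding multilinear_map_def by blast+

lemma multilinear_map_zero:
  assumes "multilinear_map scale V n g" "length xs = n" "set xs \<subseteq> tot" "0 \<in> set xs"
  shows "g xs = 0"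
proof -
  obtain k where k: "k < n" "xs ! k = 0" using assms by (auto simp: in_set_conv_nth)
  have "g (xs[k := scale 0 0]) = scale 0 (g (xs[k := 0]))"
    by (rule multilinear_map_scale[OF assms(1-3) k(1)]) (rule subspace_0[OF subspace_total])
  then show ?thesis using k list_update_id[of xs k] by simp
qed

lemma multilinear_map_sum_Cons:
  assumes g: "multilinear_map scale V (Suc n) g" and xs: "length xs = n" "set xs \<subseteq> tot"
    and a: "\<And>i. i \<in> I \<Longrightarrow> a i \<in> tot"
  shows "g ((\<Sum>i\<in>I. a i) # xs) = (\<Sum>i\<in>I. g (a i # xs))"
proof -
  have zero: "0 \<in> tot" by (rule subspace_0[OF subspace_total])
  have g0: "g (0 # xs) = 0" using multilinear_map_zero[OF g, of "0 # xs"] xs zero by simp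
  show ?thesis
    using a
  proof (induction I rule: infinite_finite_induct)
    case (insert i I)
    have "g ((0 # xs)[0 := a i + sum a I]) = g ((0 # xs)[0 := a i]) + g ((0 # xs)[0 := sum a I])"
      using xs zero insert by (intro multilinear_map_add[OF g] subspace_sum[OF subspace_total]) auto
    with insert show ?case by simp
  qed (simp_all add: g0)
qed

lemma multilinear_map_scale_Cons:
  assumes g: "multilinear_map scale V (Suc n) g" and xs: "length xs = n" "set xs \<subseteq> tot" and a: "a \<in> tot"
  shows "g (scale c a # xs) = scale c (g (a # xs))"
  using multilinear_map_scale[OF g, of "a # xs" 0 a c] xs a by simp

lemma multilinear_map_sum:
  assumes "\<And>i. i \<in> I \<Longrightarrow> multilinear_map scale V n (g i)"
  shows "multilinear_map scale V n (\<lambda>xs. \<Sum>i\<in>I. scale (c i) (g i xs))"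
proof (rule multilinear_mapI, goal_cases)
  case (1 xs)
  then show ?case
    using assms by (intro subspace_sum[OF subspace_total] subspace_scale[OF subspace_total] multilinear_map_closed)
next
  case (2 xs k a b)
  then show ?case
    by (simp add: multilinear_map_add[OF assms] scale_right_distrib sum.distrib)
next
  case (3 xs k a d)
  then show ?case
    by (simp add: multilinear_map_scale[OF assms] scale_sum_right mult.commute)
qed

text \<open>
  An update of the argument at position \<open>k\<close> becomes an update at the position to which \<open>\<sigma>\<close> moves it.
\<close>

lemma multilinear_map_permute:
  assumes g: "multilinear_map scale V n g" and \<sigma>: "\<sigma> permutes {..<n}"
  shows "multilinear_map scale V n (\<lambda>xs. g (permute_list \<sigma> xs))"
proof -
  have upd: "permute_list \<sigma> (xs[k := a]) = (permute_list \<sigma> xs)[inv \<sigma> k := a]" if "length xs = n" for xs :: "'a list" and k a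
  proof (rule nth_equalityI)
    fix i assume "i < length (permute_list \<sigma> (xs[k := a]))"
    then have i: "i < n" "\<sigma> i < n" using that permutes_in_image[OF \<sigma>, of i] by auto
    have "k = \<sigma> i \<longleftrightarrow> inv \<sigma> k = i" using permutes_inverses[OF \<sigma>] by auto
    then show "permute_list \<sigma> (xs[k := a]) ! i = (permute_list \<sigma> xs)[inv \<sigma> k := a] ! i"
      using i \<sigma> that by (auto simp: permute_list_nth nth_list_update)
  qed simp
  have set: "set (permute_list \<sigma> xs) \<subseteq> tot" if "length xs = n" "set xs \<subseteq> tot" for xs
    using that set_permute_list[of \<sigma> xs] \<sigma> by simp
  have lt: "inv \<sigma> k < n" if "k < n" for k
    using that permutes_in_image[OF permutes_inv[OF \<sigma>], of k] by simp
  show ?thesis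
    by (rule multilinear_mapI)
      (simp_all add: upd set lt multilinear_map_closed[OF g] multilinear_map_add[OF g] multilinear_map_scale[OF g])
qed

text \<open>
  The condition in the definition of \<^const>\<open>component\<close>, as a predicate. It is compatible with the vector
  space operations and determines \<open>f\<close>; hence components exist and are linear.
\<close>

definition decomposes :: "(int \<Rightarrow> 'a) \<Rightarrow> 'a \<Rightarrow> bool" where
  "decomposes f x \<longleftrightarrow> (\<forall>i. f i \<in> V i) \<and> finite {i. f i \<noteq> 0} \<and> x = (\<Sum>i | f i \<noteq> 0. f i)"

lemma decomposes_sum:
  assumes "decomposes f x" "finite I" "{i. f i \<noteq> 0} \<subseteq> I"
  shows "x = (\<Sum>i\<in>I. f i)"
proof -
  have "(\<Sum>i | f i \<noteq> 0. f i) = (\<Sum>i\<in>I. f i)"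
    using assms by (intro sum.mono_neutral_left) auto
  then show ?thesis using assms(1) by (simp add: decomposes_def)
qed

lemma decomposesI:
  assumes "\<And>i. f i \<in> V i" "finite I" "{i. f i \<noteq> 0} \<subseteq> I" "x = (\<Sum>i\<in>I. f i)"
  shows "decomposes f x"
proof -
  have "(\<Sum>i | f i \<noteq> 0. f i) = (\<Sum>i\<in>I. f i)"
    using assms by (intro sum.mono_neutral_left) auto
  then show ?thesis using assms finite_subset by (auto simp: decomposes_def)
qed

lemma decomposes_add:
  assumes "decomposes f x" "decomposes g y"
  shows "decomposes (\<lambda>i. f i + g i) (x + y)"
proof (rule decomposesI)
  let ?I = "{i. f i \<noteq> 0} \<union> {i. g i \<noteq> 0}"
  show fin: "finite ?I" using assms by (simp add: decomposes_def)
  show "x + y = (\<Sum>i\<in>?I. f i + g i)"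
    using decomposes_sum[OF assms(1) fin] decomposes_sum[OF assms(2) fin] by (simp add: sum.distrib)
qed (use assms subspace_piece in \<open>auto simp: decomposes_def intro: subspace_add\<close>)

lemma decomposes_scale:
  assumes "decomposes f x"
  shows "decomposes (\<lambda>i. scale c (f i)) (scale c x)"
proof (rule decomposesI)
  show fin: "finite {i. f i \<noteq> 0}" using assms by (simp add: decomposes_def)
  show "scale c x = (\<Sum>i | f i \<noteq> 0. scale c (f i))"
    using decomposes_sum[OF assms fin] by (simp add: scale_sum_right)
qed (use assms subspace_piece in \<open>auto simp: decomposes_def intro: subspace_scale\<close>)

lemma decomposes_unique:
  assumes "decomposes f x" "decomposes g x"
  shows "f = g"
proof
  fix d
  let ?I = "insert d ({i. f i \<noteq> 0} \<union> {i. g i \<noteq> 0})"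
  have fin: "finite ?I" using assms by (simp add: decomposes_def)
  have "x = (\<Sum>i\<in>?I. f i)" "x = (\<Sum>i\<in>?I. g i)"
    by (rule decomposes_sum[OF assms(1) fin], blast) (rule decomposes_sum[OF assms(2) fin], blast)
  then have "(\<Sum>i\<in>?I. f i - g i) = 0" by (simp only: sum_subtractf) simp
  moreover have "f i - g i \<in> V i" for i
    using assms subspace_piece by (auto simp: decomposes_def intro: subspace_diff)
  ultimately have "f d - g d = 0" using independent_pieces[OF fin, of "\<lambda>i. f i - g i" d] by blast
  then show "f d = g d" by simp
qed

lemma decomposes_imp_component:
  assumes "decomposes f x"
  shows "component V d x = f d"
proof -
  have "(THE f. decomposes f x) = f" using assms decomposes_unique by blast
  then show ?thesis unfolding component_def decomposes_def by simp
qed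

lemma decomposes_component:
  assumes "x \<in> tot"
  shows "decomposes (\<lambda>d. component V d x) x"
proof -
  have "x \<in> span (\<Union>i. V i)" using assms by (simp add: total_def)
  then have "\<exists>f. decomposes f x"
  proof (induction rule: span_induct_alt)
    case base
    have "decomposes (\<lambda>i. 0) 0"
      using subspace_0[OF subspace_piece] by (intro decomposesI[of _ "{}"]) auto
    then show ?case by blast
  next
    case (step c x y)
    then obtain d f where "x \<in> V d" "decomposes f y" by auto
    moreover have "decomposes (\<lambda>i. if i = d then x else 0) x"
      using \<open>x \<in> V d\<close> subspace_0[OF subspace_piece] by (intro decomposesI[of _ "{d}"]) auto
    ultimately show ?case using decomposes_add[OF decomposes_scale] by blast
  qed
  then obtain f where "decomposes f x" by blast
  moreover from this have "(\<lambda>d. component V d x) = f" using decomposes_imp_component by blast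
  ultimately show ?thesis by simp
qed

lemma component_add: "x \<in> tot \<Longrightarrow> y \<in> tot \<Longrightarrow> component V d (x + y) = component V d x + component V d y"
  using decomposes_imp_component[OF decomposes_add[OF decomposes_component decomposes_component]] by simp

lemma component_scale: "x \<in> tot \<Longrightarrow> component V d (scale c x) = scale c (component V d x)"
  using decomposes_imp_component[OF decomposes_scale[OF decomposes_component]] by simp

lemma component_mem: "x \<in> tot \<Longrightarrow> component V d x \<in> V d"
  using decomposes_component by (simp add: decomposes_def)

lemma finite_support: "x \<in> tot \<Longrightarrow> finite {d. component V d x \<noteq> 0}"
  using decomposes_component by (simp add: decomposes_def)

text \<open>
  The index set in the definition of the multilinear extension depends on the arguments. Enlarging it to
  all degree lists over a fixed finite set adds only vanishing summands, and then extensions at different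
  arguments can be compared.
\<close>

lemma multilinear_extension_eq_sum:
  assumes F: "\<And>ds. length ds = n \<Longrightarrow> multilinear_map scale V n (F ds)"
    and xs: "length xs = n" "set xs \<subseteq> tot"
    and I: "finite I" "\<And>x. x \<in> set xs \<Longrightarrow> {d. component V d x \<noteq> 0} \<subseteq> I"
  shows "multilinear_extension V F xs =
    (\<Sum>ds | set ds \<subseteq> I \<and> length ds = n. F ds (map2 (component V) ds xs))"
  unfolding multilinear_extension_def
proof (rule sum.mono_neutral_left)
  show "finite {ds. set ds \<subseteq> I \<and> length ds = n}" by (rule finite_lists_length_eq[OF I(1)])
  show "{ds. list_all2 (\<lambda>d x. component V d x \<noteq> 0) ds xs} \<subseteq> {ds. set ds \<subseteq> I \<and> length ds = n}"
  proof safe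
    fix ds d assume l: "list_all2 (\<lambda>d x. component V d x \<noteq> 0) ds xs"
    then show "length ds = n" using xs by (simp add: list_all2_lengthD)
    assume "d \<in> set ds"
    then obtain k where "k < length ds" "ds ! k = d" by (auto simp: in_set_conv_nth)
    then have "component V d (xs ! k) \<noteq> 0" "xs ! k \<in> set xs"
      using l by (auto simp: list_all2_conv_all_nth)
    then show "d \<in> I" using I(2) by blast
  qed
  show "\<forall>ds\<in>{ds. set ds \<subseteq> I \<and> length ds = n} - {ds. list_all2 (\<lambda>d x. component V d x \<noteq> 0) ds xs}.
      F ds (map2 (component V) ds xs) = 0"
  proof
    fix ds assume ds: "ds \<in> {ds. set ds \<subseteq> I \<and> length ds = n} - {ds. list_all2 (\<lambda>d x. component V d x \<noteq> 0) ds xs}"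
    then obtain k where "k < n" "component V (ds ! k) (xs ! k) = 0"
      using xs by (auto simp: list_all2_conv_all_nth)
    then have "map2 (component V) ds xs ! k = 0" "k < length (map2 (component V) ds xs)" using ds xs by auto
    then have "0 \<in> set (map2 (component V) ds xs)" by (metis nth_mem)
    moreover have "set (map2 (component V) ds xs) \<subseteq> tot"
      using xs component_mem piece_total by (fastforce dest: set_zip_rightD)
    ultimately show "F ds (map2 (component V) ds xs) = 0"
      using ds xs by (intro multilinear_map_zero[OF F]) auto
  qed
qed

lemma multilinear_map_extension:
  assumes F: "\<And>ds. length ds = n \<Longrightarrow> multilinear_map scale V n (F ds)"
  shows "multilinear_map scale V n (multilinear_extension V F)"
proof -
  have set: "set (map2 (component V) ds xs) \<subseteq> tot" if "set xs \<subseteq> tot" for ds xs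
    using that component_mem piece_total by (fastforce dest: set_zip_rightD)
  have upd: "map2 (component V) ds (xs[k := a]) = (map2 (component V) ds xs)[k := component V (ds ! k) a]"
    if "length ds = n" "length xs = n" for ds xs k a
    using that
  proof (intro nth_equalityI)
    fix i assume "i < length (map2 (component V) ds (xs[k := a]))"
    then show "map2 (component V) ds (xs[k := a]) ! i = (map2 (component V) ds xs)[k := component V (ds ! k) a] ! i"
      using that by (cases "i = k") auto
  qed simp
  define supp where "supp x = {d. component V d x \<noteq> 0}" for x
  define S where "S xs = (\<Union>x\<in>set xs. supp x)" for xs
  have S: "finite (S xs)" "supp x \<subseteq> S xs" if "set xs \<subseteq> tot" "x \<in> set xs" for x xs
    using that finite_support by (auto simp: S_def supp_def)
  have finS: "finite (S xs)" if "set xs \<subseteq> tot" for xs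
    using that finite_support by (auto simp: S_def supp_def)
  have eq: "multilinear_extension V F (xs[k := a]) =
      (\<Sum>ds | set ds \<subseteq> I \<and> length ds = n. F ds ((map2 (component V) ds xs)[k := component V (ds ! k) a]))"
    if "length xs = n" "set xs \<subseteq> tot" "a \<in> tot" "finite I" "S xs \<subseteq> I" "supp a \<subseteq> I" for xs k a I
  proof -
    have "multilinear_extension V F (xs[k := a]) =
        (\<Sum>ds | set ds \<subseteq> I \<and> length ds = n. F ds (map2 (component V) ds (xs[k := a])))"
    proof (rule multilinear_extension_eq_sum[OF F _ _ that(4)])
      fix x assume "x \<in> set (xs[k := a])"
      then have "x \<in> set xs \<or> x = a" using set_update_subset_insert[of xs k a] by auto
      then show "{d. component V d x \<noteq> 0} \<subseteq> I" using that(5,6) by (auto simp: S_def supp_def)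
    qed (use that set_update_subset_insert[of xs k a] in auto)
    also have "\<dots> = (\<Sum>ds | set ds \<subseteq> I \<and> length ds = n. F ds ((map2 (component V) ds xs)[k := component V (ds ! k) a]))"
      using upd that(1) by (intro sum.cong) auto
    finally show ?thesis .
  qed
  have comp_tot: "component V d a \<in> tot" if "a \<in> tot" for d a
    using that component_mem piece_total by blast
  have fin: "finite (supp a)" if "a \<in> tot" for a using that finite_support by (simp add: supp_def)
  show ?thesis
  proof (rule multilinear_mapI, goal_cases)
    case (1 xs)
    have "multilinear_extension V F xs = (\<Sum>ds | set ds \<subseteq> S xs \<and> length ds = n. F ds (map2 (component V) ds xs))"
      using 1 finS by (intro multilinear_extension_eq_sum[OF F]) (auto simp: S_def supp_def)
    also have "\<dots> \<in> tot"
      using 1 set by (intro subspace_sum[OF subspace_total] multilinear_map_closed[OF F]) auto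
    finally show ?case .
  next
    case (2 xs k a b)
    let ?I = "S xs \<union> supp a \<union> supp b"
    have I: "finite ?I" using 2 fin finS by simp
    have ab: "a + b \<in> tot" using 2 subspace_add[OF subspace_total] by blast
    have "supp (a + b) \<subseteq> ?I" using 2 component_add by (auto simp: supp_def)
    moreover have "F ds ((map2 (component V) ds xs)[k := component V (ds ! k) (a + b)]) =
        F ds ((map2 (component V) ds xs)[k := component V (ds ! k) a]) +
        F ds ((map2 (component V) ds xs)[k := component V (ds ! k) b])" if "length ds = n" for ds
      using multilinear_map_add[OF F[OF that], of "map2 (component V) ds xs" k] 2 set[of xs ds] that comp_tot
      by (simp add: component_add)
    ultimately show ?case
      using 2 ab I by (simp add: eq[where I = ?I] le_supI1 sum.distrib[symmetric])
  next
    case (3 xs k a c)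
    let ?I = "S xs \<union> supp a"
    have I: "finite ?I" using 3 fin finS by simp
    have ca: "scale c a \<in> tot" using 3 subspace_scale[OF subspace_total] by blast
    have "supp (scale c a) \<subseteq> ?I" using 3 component_scale by (auto simp: supp_def)
    moreover have "F ds ((map2 (component V) ds xs)[k := component V (ds ! k) (scale c a)]) =
        scale c (F ds ((map2 (component V) ds xs)[k := component V (ds ! k) a]))" if "length ds = n" for ds
      using multilinear_map_scale[OF F[OF that], of "map2 (component V) ds xs" k] 3 set[of xs ds] that comp_tot
      by (simp add: component_scale)
    ultimately show ?case
      using 3 ca I by (simp add: eq[where I = ?I] scale_sum_right)
  qed
qed

end

section \<open>Graded symmetry in terms of words\<close>

context graded_vector_space begin

lemma bilinear:
  assumes f: "multilinear_map scale V 2 (binary f)" and "a \<in> tot" "b \<in> tot" "c \<in> tot"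
  shows "f (a + b) c = f a c + f b c" "f c (a + b) = f c a + f c b"
    "f (scale k a) c = scale k (f a c)" "f c (scale k a) = scale k (f c a)"
  using multilinear_map_add[OF f, of "[a, c]" 0 a b] multilinear_map_add[OF f, of "[c, a]" 1 a b]
    multilinear_map_scale[OF f, of "[a, c]" 0 a k] multilinear_map_scale[OF f, of "[c, a]" 1 a k] assms
  by (simp_all add: binary_def)

lemma binary_degree:
  assumes "has_degree V 2 (binary f) m" "a \<in> V p" "b \<in> V q"
  shows "f a b \<in> V (p + q + m)"
  using assms(1)[unfolded has_degree_def, rule_format, of "[a, b]" "[p, q]"] assms(2,3)
  by (simp add: homogeneous_def binary_def)

text \<open>
  Two letters have only one nontrivial permutation, the exchange of two blocks of length one.
\<close>

lemma binary_commute: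
  assumes "graded_symmetric scale V 2 (binary f)" "a \<in> V p" "b \<in> V q"
  shows "f a b = scale ((-1) powi (p * q)) (f b a)"
  using assms(1)[unfolded graded_symmetric_def, rule_format, of "[a, b]" "[p, q]" "swap_blocks 0 1 1"] assms(2,3)
    koszul_sign_swap_blocks[where ?'k = 'k, of "[]" "[p]" "[q]" "[]"] permute_swap_blocks[of "[]" "[a]" "[b]" "[]"]
    swap_blocks_permutes[of 0 1 1 2]
  by (simp add: homogeneous_def binary_def)

lemma words_zip:
  assumes "homogeneous V ds xs" "length xs = n"
  shows "zip ds xs \<in> words n" "map fst (zip ds xs) = ds" "map snd (zip ds xs) = xs"
  using assms by (auto simp: words_def homogeneous_def list_all2_iff)

lemma words_homogeneous: "z \<in> words n \<Longrightarrow> homogeneous V (map fst z) (map snd z)"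
  by (auto simp: words_def homogeneous_def list_all2_map1 list_all2_map2 list_all2_same)

lemma words_total:
  assumes "z \<in> words n"
  shows "set (map snd z) \<subseteq> tot"
  using assms piece_total by (fastforce simp: words_def)

lemma graded_symmetricI:
  assumes "\<And>z \<sigma>. z \<in> words n \<Longrightarrow> \<sigma> permutes {..<n} \<Longrightarrow> koszul_act (\<lambda>z. g (map snd z)) \<sigma> z = g (map snd z)"
  shows "graded_symmetric scale V n g"
  unfolding graded_symmetric_def
proof (intro allI impI)
  fix ds xs \<sigma> assume "length xs = n" "homogeneous V ds xs" and \<sigma>: "\<sigma> permutes {..<n}"
  note z = words_zip[OF this(2,1)]
  have "length (zip ds xs) = n" using z(1) by (rule words_length)
  then have "map snd (permute_list \<sigma> (zip ds xs)) = permute_list \<sigma> xs"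
    using \<sigma> z(3) by (metis permute_list_map)
  then show "g xs = scale (koszul_sign ds \<sigma>) (g (permute_list \<sigma> xs))"
    using assms[OF z(1) \<sigma>] z(2,3) by (simp add: koszul_act_def)
qed

lemma graded_symmetric_swap_invariant:
  assumes g: "graded_symmetric scale V n g"
  shows "swap_invariant n (\<lambda>z. g (map snd z)) k"
  unfolding swap_invariant_def
proof (intro allI impI)
  fix u a b v assume z: "u @ [a, b] @ v \<in> words n"
  let ?z = "u @ [a] @ [b] @ v"
  have hom: "homogeneous V (map fst ?z) (map snd ?z)"
    using words_homogeneous[OF z] by simp
  have len: "length (map snd ?z) = n" using words_length[OF z] by simp
  have "swap_blocks (length u) 1 1 permutes {..<n}"
    using len by (intro swap_blocks_permutes) simp
  then show "g (map snd (u @ [a, b] @ v)) = scale ((-1) powi (fst a * fst b)) (g (map snd (u @ [b, a] @ v)))"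
    using g[unfolded graded_symmetric_def, rule_format, OF len hom, of "swap_blocks (length u) 1 1"]
      permute_swap_blocks[of "map snd u" "[snd a]" "[snd b]" "map snd v"]
      koszul_sign_swap_blocks[where ?'k = 'k, of "map fst u" "[fst a]" "[fst b]" "map fst v"]
    by simp
qed

lemma symmetrization_sum_koszul_act:
  assumes "z \<in> words n" "\<And>\<sigma>. \<sigma> \<in> P \<Longrightarrow> \<sigma> permutes {..<n}"
  shows "symmetrization n (\<lambda>z. \<Sum>\<sigma>\<in>P. koszul_act f \<sigma> z) z = scale (of_nat (card P)) (symmetrization n f z)"
  using assms by (simp add: symmetrization_sum symmetrization_koszul_act sum_constant_scale)

end

section \<open>The higher brackets\<close>

context Gerstenhaber_algebra begin

lemmas product_closed = binary_closed[OF product_multilinear]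
lemmas bracket_closed = binary_closed[OF bracket_multilinear]
lemmas product_linear = bilinear[OF product_multilinear]
lemmas bracket_linear = bilinear[OF bracket_multilinear]
lemmas product_commute = binary_commute[OF product_symmetric]
lemmas bracket_commute = binary_commute[OF bracket_symmetric]

lemma product_mem: "a \<in> A p \<Longrightarrow> b \<in> A q \<Longrightarrow> \<mu> a b \<in> A (p + q)"
  using binary_degree[OF product_degree] by simp

lemma bracket_mem: "a \<in> A p \<Longrightarrow> b \<in> A q \<Longrightarrow> \<nu> a b \<in> A (p + q - 1)"
  using binary_degree[OF bracket_degree] by simp

lemma foldl_closed: "c \<in> tot \<Longrightarrow> set xs \<subseteq> tot \<Longrightarrow> foldl \<mu> c xs \<in> tot"
  by (induction xs arbitrary: c) (auto simp: product_closed)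

lemma foldl_add:
  "c \<in> tot \<Longrightarrow> d \<in> tot \<Longrightarrow> set xs \<subseteq> tot \<Longrightarrow> foldl \<mu> (c + d) xs = foldl \<mu> c xs + foldl \<mu> d xs"
  by (induction xs arbitrary: c d) (auto simp: product_closed product_linear)

lemma foldl_scale:
  "c \<in> tot \<Longrightarrow> set xs \<subseteq> tot \<Longrightarrow> foldl \<mu> (scale k c) xs = scale k (foldl \<mu> c xs)"
  by (induction xs arbitrary: c) (auto simp: product_closed product_linear)

lemma foldl_sum:
  assumes "\<And>i. i \<in> I \<Longrightarrow> c i \<in> tot" "set xs \<subseteq> tot"
  shows "foldl \<mu> (\<Sum>i\<in>I. c i) xs = (\<Sum>i\<in>I. foldl \<mu> (c i) xs)"
  using assms
proof (induction I rule: infinite_finite_induct)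
  case (insert i I)
  then show ?case by (simp add: foldl_add subspace_sum[OF subspace_total])
qed (simp_all add: foldl_product_zero zero_total)

lemma foldl_mem:
  "c \<in> A p \<Longrightarrow> z \<in> words n \<Longrightarrow> foldl \<mu> c (map snd z) \<in> A (p + word_degree z)"
proof (induction z arbitrary: c p n)
  case (Cons x z)
  then have "\<mu> c (snd x) \<in> A (p + fst x)" "z \<in> words (length z)"
    by (auto simp: words_Cons intro: product_mem)
  then show ?case using Cons.IH[of "\<mu> c (snd x)" "p + fst x"] by (simp add: add.assoc)
qed simp

text \<open>
  The summand of the identity permutation in the higher bracket; the other summands are its images under
  the action of the unshuffles, see \<open>higher_bracket_unshuffles\<close>.
\<close>

definition leading_term :: "'a list \<Rightarrow> 'a" where
  "leading_term xs = foldl \<mu> (\<nu> (xs ! 0) (xs ! 1)) (drop 2 xs)"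

lemma leading_term_Cons: "leading_term (x # y # zs) = foldl \<mu> (\<nu> x y) zs"
  by (simp add: leading_term_def)

lemma words_at_least_two:
  assumes "z \<in> words n" "2 \<le> n"
  obtains x y r where "z = x # y # r" "snd x \<in> A (fst x)" "snd y \<in> A (fst y)" "r \<in> words (n - 2)"
proof -
  have "length z = Suc (Suc (n - 2))" using assms words_length by fastforce
  then obtain x y r where "z = x # y # r" "length r = n - 2" by (auto simp: length_Suc_conv)
  then show ?thesis using assms(1) that by (auto simp: words_Cons)
qed

lemma leading_term_mem:
  assumes "z \<in> words n" "2 \<le> n"
  shows "leading_term (map snd z) \<in> A (word_degree z - 1)"
proof -
  obtain x y r where "z = x # y # r" "snd x \<in> A (fst x)" "snd y \<in> A (fst y)" "r \<in> words (n - 2)"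
    by (rule words_at_least_two[OF assms])
  then show ?thesis
    using foldl_mem[OF bracket_mem] by (fastforce simp: leading_term_Cons algebra_simps)
qed

text \<open>
  The three kinds of positions are the two entries of the bracket and the factors of the product. A
  factor is split off as the right operand of the product of everything in front of it.
\<close>

lemma leading_term_multilinear:
  assumes "2 \<le> n"
  shows "multilinear_map scale A n leading_term"
proof -
  have split: "\<exists>x y r. xs = x # y # r \<and> x \<in> tot \<and> y \<in> tot \<and> set r \<subseteq> tot" if "length xs = n" "set xs \<subseteq> tot" for xs
  proof -
    have "length xs = Suc (Suc (n - 2))" using that(1) assms by simp
    then show ?thesis using that(2) by (auto simp: length_Suc_conv)
  qed
  have upd: "leading_term ((x # y # r)[k := a]) =
      (if k = 0 then foldl \<mu> (\<nu> a y) r else if k = 1 then foldl \<mu> (\<nu> x a) r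
       else foldl \<mu> (\<mu> (foldl \<mu> (\<nu> x y) (take (k - 2) r)) a) (drop (Suc (k - 2)) r))"
    if "k < Suc (Suc (length r))" for x y r k a
  proof -
    consider "k = 0" | "k = 1" | "k = Suc (Suc (k - 2))" by linarith
    then show ?thesis
    proof cases
      case 3
      then obtain m where "k = Suc (Suc m)" by blast
      with \<open>k < Suc (Suc (length r))\<close> show ?thesis
        by (simp add: leading_term_Cons upd_conv_take_nth_drop)
    qed (simp_all add: leading_term_Cons)
  qed
  show ?thesis
  proof (rule multilinear_mapI, goal_cases)
    case (1 xs)
    then show ?case using split[OF 1] by (auto simp: leading_term_Cons intro!: foldl_closed bracket_closed)
  next
    case (2 xs k a b)
    then obtain x y r where xs: "xs = x # y # r" "x \<in> tot" "y \<in> tot" "set r \<subseteq> tot" using split by blast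
    then have "set (take (k - 2) r) \<subseteq> tot" "set (drop (Suc (k - 2)) r) \<subseteq> tot"
      using set_take_subset set_drop_subset by fast+
    with xs 2 show ?case
      by (simp add: upd bracket_linear product_linear foldl_add bracket_closed product_closed foldl_closed del: list_update.simps)
  next
    case (3 xs k a c)
    then obtain x y r where xs: "xs = x # y # r" "x \<in> tot" "y \<in> tot" "set r \<subseteq> tot" using split by blast
    then have "set (take (k - 2) r) \<subseteq> tot" "set (drop (Suc (k - 2)) r) \<subseteq> tot"
      using set_take_subset set_drop_subset by fast+
    with xs 3 show ?case
      by (simp add: upd bracket_linear product_linear foldl_scale bracket_closed product_closed foldl_closed del: list_update.simps)
  qed
qed

abbreviation hb :: "nat \<Rightarrow> 'a list \<Rightarrow> 'a" where "hb \<equiv> higher_bracket scale A \<nu> \<mu>"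

lemma leading_term_permute:
  assumes "length xs = n" "2 \<le> n" "\<sigma> permutes {..<n}"
  shows "leading_term (permute_list \<sigma> xs) = foldl \<mu> (\<nu> (xs ! \<sigma> 0) (xs ! \<sigma> 1)) (map (\<lambda>i. xs ! \<sigma> i) [2..<n])"
  using assms unfolding leading_term_def
  by (simp add: permute_list_nth) (simp add: permute_list_def drop_map numeral_2_eq_2)

lemma higher_bracket_multilinear:
  "multilinear_map scale A n (hb n)"
proof -
  consider "n \<le> 1" | "n = 2" | "3 \<le> n" by linarith
  then show ?thesis
  proof cases
    case 1
    then show ?thesis by (auto simp: higher_bracket_def multilinear_map_def zero_total)
  next
    case 2
    then show ?thesis by (simp add: higher_bracket_def bracket_multilinear)
  next
    case 3
    have perm: "\<sigma> permutes {..<n}" if "\<sigma> \<in> unshuffles [2, n - 2]" for \<sigma>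
      using unshuffle_permutes[OF that, of n] 3 by simp
    have "multilinear_map scale A n (higher_bracket_hom scale \<nu> \<mu> n ds)" for ds
    proof -
      have m: "multilinear_map scale A n
          (\<lambda>xs. \<Sum>\<sigma>\<in>unshuffles [2, n - 2]. scale (koszul_sign ds \<sigma>) (leading_term (permute_list \<sigma> xs)))"
        using 3 perm by (intro multilinear_map_sum multilinear_map_permute leading_term_multilinear) auto
      have "higher_bracket_hom scale \<nu> \<mu> n ds xs =
          (\<Sum>\<sigma>\<in>unshuffles [2, n - 2]. scale (koszul_sign ds \<sigma>) (leading_term (permute_list \<sigma> xs)))"
        if "length xs = n" for xs
        unfolding higher_bracket_hom_def using that 3 perm
        by (intro sum.cong) (auto simp: leading_term_permute)
      with m show ?thesis unfolding multilinear_map_def by simp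
    qed
    then show ?thesis using 3 multilinear_map_extension by (simp add: higher_bracket_def)
  qed
qed

text \<open>
  For two arguments the only unshuffle is the identity, so the formula also covers the bracket itself.
\<close>

lemma higher_bracket_unshuffles:
  assumes n: "2 \<le> n" and z: "z \<in> words n"
  shows "hb n (map snd z) = (\<Sum>\<sigma>\<in>unshuffles [2, n - 2]. koszul_act (\<lambda>z. leading_term (map snd z)) \<sigma> z)"
proof (cases "n = 2")
  case True
  have "\<sigma> = id" if "\<sigma> \<in> unshuffles [2, 0]" for \<sigma>
  proof -
    have p: "\<sigma> permutes {..<2}" and lt: "\<sigma> 0 < \<sigma> 1" using that by (auto simp: unshuffles_two_iff)
    have "\<sigma> 1 < 2" using permutes_in_image[OF p, of 1] by simp
    then have "\<sigma> i = i" for i using lt permutes_not_in[OF p, of i]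
      by (cases "i = 0"; cases "i = 1") auto
    then show "\<sigma> = id" by auto
  qed
  then have "unshuffles [2, 0] = {id}" using id_unshuffle by blast
  then show ?thesis
    using True words_length[OF z]
    by (simp add: koszul_act_def koszul_sign_id higher_bracket_def binary_def leading_term_def)
next
  case False
  note hom = words_homogeneous[OF z]
  have perm: "\<sigma> permutes {..<n}" if "\<sigma> \<in> unshuffles [2, n - 2]" for \<sigma>
    using unshuffle_permutes[OF that, of n] n by simp
  show ?thesis
    unfolding higher_bracket_homogeneous[OF _ _ hom, of n]
    using False n words_length[OF z] perm
    by (subst higher_bracket_homogeneous[OF _ _ hom])
      (auto intro!: sum.cong simp: koszul_act_def leading_term_permute permute_list_map[symmetric])
qed

lemma koszul_act_mem:
  assumes z: "z \<in> words n" and \<sigma>: "\<sigma> permutes {..<n}"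
    and f: "\<And>y. y \<in> words n \<Longrightarrow> f y \<in> A (word_degree y + m)"
  shows "koszul_act f \<sigma> z \<in> A (word_degree z + m)"
proof -
  have "mset (permute_list \<sigma> z) = mset z" using \<sigma> words_length[OF z] by simp
  then have "word_degree (permute_list \<sigma> z) = word_degree z"
    unfolding word_degree_def by (metis mset_map sum_mset_sum_list)
  then show ?thesis
    using f[OF words_permute[OF z \<sigma>]] subspace_scale[OF subspace_piece] by (simp add: koszul_act_def)
qed

lemma higher_bracket_mem:
  assumes n: "2 \<le> n" and z: "z \<in> words n"
  shows "hb n (map snd z) \<in> A (word_degree z - 1)"
  unfolding higher_bracket_unshuffles[OF n z]
  using n koszul_act_mem[OF z, of _ "\<lambda>z. leading_term (map snd z)" "-1"] leading_term_mem[OF _ n]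
  by (intro subspace_sum[OF subspace_piece]) (auto dest!: unshuffle_permutes[where n = n])

text \<open>
  The excluded position \<open>k = 1\<close> is the boundary between the bracket and the factors that follow it.
\<close>

lemma leading_term_swap_invariant:
  assumes "k \<noteq> 1"
  shows "swap_invariant n (\<lambda>z. leading_term (map snd z)) k"
  unfolding swap_invariant_def
proof (intro allI impI)
  fix u a b v assume z: "u @ [a, b] @ v \<in> words n" and k: "length u = k"
  have a: "snd a \<in> A (fst a)" "snd b \<in> A (fst b)" and uv: "u \<in> words k" "v \<in> words (length v)"
    using z k by (auto simp: words_append words_Cons)
  note tot = piece_total[OF a(1)] piece_total[OF a(2)] words_total[OF uv(1)] words_total[OF uv(2)]
  show "leading_term (map snd (u @ [a, b] @ v)) =
      scale ((-1) powi (fst a * fst b)) (leading_term (map snd (u @ [b, a] @ v)))"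
  proof (cases "k = 0")
    case True
    then show ?thesis
      using k tot bracket_commute[OF a] by (simp add: leading_term_Cons foldl_scale bracket_closed)
  next
    case False
    then have "2 \<le> k" using assms by simp
    let ?c = "leading_term (map snd u)"
    have u: "leading_term (map snd (u @ r)) = foldl \<mu> ?c (map snd r)" for r
      by (rule words_at_least_two[OF uv(1) \<open>2 \<le> k\<close>]) (simp add: leading_term_Cons)
    have c: "?c \<in> tot" using piece_total[OF leading_term_mem[OF uv(1) \<open>2 \<le> k\<close>]] .
    have "\<mu> (\<mu> ?c (snd a)) (snd b) = scale ((-1) powi (fst a * fst b)) (\<mu> (\<mu> ?c (snd b)) (snd a))"
      using tot c product_commute[OF a] by (simp add: product_assoc product_linear product_closed)
    then show ?thesis
      unfolding u using tot c by (simp add: foldl_scale product_closed)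
  qed
qed

text \<open>
  The higher bracket is a nonzero multiple of the symmetrization of its leading term, by
  \<open>symmetrization_unshuffles\<close>.
\<close>

lemma higher_bracket_symmetric: "graded_symmetric scale A n (hb n)"
proof (cases "2 \<le> n")
  case False
  then show ?thesis by (auto simp: higher_bracket_def graded_symmetric_def)
next
  case n: True
  let ?T = "\<lambda>z. leading_term (map snd z)"
  define c :: 'k where "c = fact 2 * fact (n - 2)"
  have c: "c \<noteq> 0" by (simp add: c_def)
  have sym: "hb n (map snd z) = scale (1 / c) (symmetrization n ?T z)" if z: "z \<in> words n" for z
  proof -
    have eq: "2 + (n - 2) = n" using n by simp
    have "symmetrization n ?T z = scale (fact 2 * fact (n - 2)) (\<Sum>\<sigma>\<in>unshuffles [2, n - 2]. koszul_act ?T \<sigma> z)"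
      by (rule symmetrization_unshuffles[of 2 "n - 2", unfolded eq])
        (use leading_term_swap_invariant z in auto)
    then have "symmetrization n ?T z = scale c (hb n (map snd z))"
      using n z by (simp add: c_def higher_bracket_unshuffles)
    then show ?thesis using c by simp
  qed
  show ?thesis
  proof (rule graded_symmetricI)
    fix z \<sigma> assume z: "z \<in> words n" and \<sigma>: "\<sigma> permutes {..<n}"
    have "koszul_act (\<lambda>z. hb n (map snd z)) \<sigma> z = koszul_act (\<lambda>z. scale (1 / c) (symmetrization n ?T z)) \<sigma> z"
      by (rule koszul_act_cong[OF z \<sigma> sym])
    also have "\<dots> = scale (1 / c) (koszul_act (symmetrization n ?T) \<sigma> z)"
      by (simp add: koszul_act_def mult.commute)
    also have "\<dots> = hb n (map snd z)"
      using sym[OF z] koszul_act_symmetrization[OF z \<sigma>] by simp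
    finally show "koszul_act (\<lambda>z. hb n (map snd z)) \<sigma> z = hb n (map snd z)" .
  qed
qed

end

section \<open>The Jacobi identities\<close>

context Gerstenhaber_algebra begin

lemma move_into_foldl:
  assumes c: "c \<in> A p" and e: "e \<in> A q" and a: "a \<in> words n"
  shows "\<mu> (foldl \<mu> c (map snd a)) e = scale ((-1) powi (q * word_degree a)) (foldl \<mu> (\<mu> c e) (map snd a))"
  using c a
proof (induction a arbitrary: c p n)
  case Nil
  then show ?case by simp
next
  case (Cons x a)
  then have x: "snd x \<in> A (fst x)" and a: "a \<in> words (length a)" by (auto simp: words_Cons)
  note tot = piece_total[OF x] piece_total[OF e] piece_total[OF Cons.prems(1)] words_total[OF a]
  have "\<mu> (foldl \<mu> (\<mu> c (snd x)) (map snd a)) e =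
      scale ((-1) powi (q * word_degree a)) (foldl \<mu> (\<mu> (\<mu> c (snd x)) e) (map snd a))"
    by (rule Cons.IH[OF product_mem[OF Cons.prems(1) x] a])
  also have "\<mu> (\<mu> c (snd x)) e = scale ((-1) powi (fst x * q)) (\<mu> (\<mu> c e) (snd x))"
    using product_commute[OF x e] tot by (simp add: product_assoc product_linear product_closed)
  finally show ?case
    using tot by (simp add: foldl_scale product_closed power_int_add distrib_left mult.commute)
qed

text \<open>
  The Leibniz rule in the first argument of the bracket, obtained from the rule in the second one by
  graded symmetry. The signs are the Koszul signs of moving the odd symbol \<open>\<nu>\<close> past \<open>w\<close> and of exchanging
  \<open>a\<close> and \<open>b\<close>.
\<close>

lemma bracket_Leibniz_right:
  assumes w: "w \<in> A p" and a: "a \<in> A q" and b: "b \<in> A r"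
  shows "\<nu> (\<mu> w a) b = scale ((-1) powi p) (\<mu> w (\<nu> a b)) + scale ((-1) powi (q * r)) (\<mu> (\<nu> w b) a)"
proof -
  note tot = piece_total[OF w] piece_total[OF a] piece_total[OF b]
  have "\<nu> (\<mu> w a) b = scale ((-1) powi ((p + q) * r)) (\<nu> b (\<mu> w a))"
    by (rule bracket_commute[OF product_mem[OF w a] b])
  also have "\<nu> b (\<mu> w a) = \<mu> (\<nu> b w) a + scale ((-1) powi ((r - 1) * p)) (\<mu> w (\<nu> b a))"
    by (rule bracket_Leibniz[OF b w a])
  also have "\<nu> b w = scale ((-1) powi (r * p)) (\<nu> w b)" by (rule bracket_commute[OF b w])
  also have "\<nu> b a = scale ((-1) powi (r * q)) (\<nu> a b)" by (rule bracket_commute[OF b a])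
  finally have eq: "\<nu> (\<mu> w a) b =
      scale ((-1) powi ((p + q) * r) * (-1) powi (r * p)) (\<mu> (\<nu> w b) a) +
      scale ((-1) powi ((p + q) * r) * ((-1) powi ((r - 1) * p) * (-1) powi (r * q))) (\<mu> w (\<nu> a b))"
    using tot by (simp add: product_linear bracket_closed scale_right_distrib)
  have s1: "(-1 :: 'k) powi ((p + q) * r) * (-1) powi (r * p) = (-1) powi (q * r)"
    by (auto simp: sign_powi)
  have s2: "(-1 :: 'k) powi ((p + q) * r) * ((-1) powi ((r - 1) * p) * (-1) powi (r * q)) = (-1) powi p"
    by (auto simp: sign_powi)
  show ?thesis unfolding eq s1 s2 by (rule add.commute)
qed

text \<open>
  The two kinds of terms in \<open>\<nu>\<^sub>j (\<nu>\<^sub>i \<dots>) \<dots>\<close>: with \<open>w\<close> the leading term of the first \<open>i\<close> letters and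
  \<open>a, b, \<dots>\<close> the remaining ones, the bracket of \<open>\<nu>\<^sub>j\<close> is applied either to \<open>w\<close> and \<open>a\<close>, or to \<open>a\<close> and \<open>b\<close>.
  In the second case the sign is that of moving the odd symbol of the bracket past \<open>w\<close>.
\<close>

definition nested_bracket_term :: "nat \<Rightarrow> (int \<times> 'a) list \<Rightarrow> 'a" where
  "nested_bracket_term i z = leading_term (leading_term (map snd (take i z)) # map snd (drop i z))"

definition two_bracket_term :: "nat \<Rightarrow> (int \<times> 'a) list \<Rightarrow> 'a" where
  "two_bracket_term i z = scale ((-1) powi (word_degree (take i z) - 1))
     (foldl \<mu> (\<mu> (leading_term (map snd (take i z))) (\<nu> (snd (z ! i)) (snd (z ! Suc i))))
       (map snd (drop (i + 2) z)))"

lemma nested_bracket_term_append: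
  "length u = i \<Longrightarrow> nested_bracket_term i (u @ b # v) = foldl \<mu> (\<nu> (leading_term (map snd u)) (snd b)) (map snd v)"
  by (simp add: nested_bracket_term_def leading_term_Cons)

lemma two_bracket_term_append:
  "length u = i \<Longrightarrow> two_bracket_term i (u @ a # b # v) = scale ((-1) powi (word_degree u - 1))
     (foldl \<mu> (\<mu> (leading_term (map snd u)) (\<nu> (snd a) (snd b))) (map snd v))"
  by (simp add: two_bracket_term_def nth_append)

lemma length_two: "length xs = 2 \<Longrightarrow> \<exists>a b. xs = [a, b]"
  by (auto simp: numeral_2_eq_2 length_Suc_conv)

text \<open>
  The expression is \<open>\<nu> x\<^sub>1 x\<^sub>2 \<cdot> \<nu> x\<^sub>3 x\<^sub>4 \<cdot> \<dots>\<close> up to sign. Exchanging the two pairs of arguments gives its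
  negative: compared with the exchange of the arguments, the exchange of the two brackets also exchanges
  their odd symbols \<open>\<nu>\<close>, which costs one more sign.
\<close>

lemma symmetrization_two_bracket_base:
  assumes n: "4 \<le> n" and z: "z \<in> words n"
  shows "symmetrization n (two_bracket_term 2) z = 0"
proof -
  have "symmetrization n (two_bracket_term 2) z = symmetrization n (\<lambda>z. - two_bracket_term 2 z) z"
  proof (rule symmetrization_swap_blocks[OF z, of 0 2 2])
    show "0 + 2 + 2 \<le> n" using n by simp
    fix u a b v assume w: "u @ a @ b @ v \<in> words n" and len: "length u = 0" "length a = 2" "length b = 2"
    obtain a1 a2 b1 b2 where ab: "a = [a1, a2]" "b = [b1, b2]" using length_two len by metis
    have mem: "snd a1 \<in> A (fst a1)" "snd a2 \<in> A (fst a2)" "snd b1 \<in> A (fst b1)" "snd b2 \<in> A (fst b2)"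
      and v: "v \<in> words (length v)" using w len by (auto simp: ab words_Cons)
    let ?a = "\<nu> (snd a1) (snd a2)" and ?b = "\<nu> (snd b1) (snd b2)"
    have m: "?a \<in> A (fst a1 + fst a2 - 1)" "?b \<in> A (fst b1 + fst b2 - 1)" using mem bracket_mem by auto
    note tot = piece_total[OF m(1)] piece_total[OF m(2)] words_total[OF v]
    have s: "(-1 :: 'k) powi (fst a1 + fst a2 - 1) * (-1) powi ((fst a1 + fst a2 - 1) * (fst b1 + fst b2 - 1)) =
        - ((-1) powi ((fst a1 + fst a2) * (fst b1 + fst b2)) * (-1) powi (fst b1 + fst b2 - 1))"
      by (auto simp: sign_powi)
    have t: "two_bracket_term 2 (x1 # x2 # y1 # y2 # v) = scale ((-1) powi (fst x1 + fst x2 - 1))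
        (foldl \<mu> (\<mu> (\<nu> (snd x1) (snd x2)) (\<nu> (snd y1) (snd y2))) (map snd v))" for x1 x2 y1 y2
      using two_bracket_term_append[of "[x1, x2]" 2 y1 y2 v] by (simp add: leading_term_Cons)
    have "\<mu> ?a ?b = scale ((-1) powi ((fst a1 + fst a2 - 1) * (fst b1 + fst b2 - 1))) (\<mu> ?b ?a)"
      by (rule product_commute[OF m])
    then have "two_bracket_term 2 (a @ b @ v) =
        scale ((-1) powi (fst a1 + fst a2 - 1) * (-1) powi ((fst a1 + fst a2 - 1) * (fst b1 + fst b2 - 1)))
          (foldl \<mu> (\<mu> ?b ?a) (map snd v))"
      using tot by (simp add: ab t foldl_scale product_closed)
    also have "\<dots> = scale ((-1) powi (word_degree a * word_degree b)) (- two_bracket_term 2 (b @ a @ v))"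
      unfolding s by (simp add: ab t)
    finally show "two_bracket_term 2 (u @ a @ b @ v) =
        scale ((-1) powi (word_degree a * word_degree b)) (- two_bracket_term 2 (u @ b @ a @ v))"
      using len by simp
  qed
  then show ?thesis
    unfolding symmetrization_minus by (rule eq_minus_self_imp_zero)
qed

text \<open>
  Moving the second bracket in front of the factors \<open>x\<^sub>3 \<dots> x\<^sub>i\<close> reduces to the case \<open>i = 2\<close>.
\<close>

lemma symmetrization_two_bracket:
  assumes i: "2 \<le> i" "i + 2 \<le> n" and z: "z \<in> words n"
  shows "symmetrization n (two_bracket_term i) z = 0"
proof -
  have "symmetrization n (two_bracket_term i) z = symmetrization n (two_bracket_term 2) z"
  proof (rule symmetrization_swap_blocks[OF z, of 2 "i - 2" 2])
    show "2 + (i - 2) + 2 \<le> n" using i by simp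
    fix u a b v assume w: "u @ a @ b @ v \<in> words n" and len: "length u = 2" "length a = i - 2" "length b = 2"
    obtain u1 u2 b1 b2 where ub: "u = [u1, u2]" "b = [b1, b2]" using length_two len by metis
    have mem: "snd u1 \<in> A (fst u1)" "snd u2 \<in> A (fst u2)" "snd b1 \<in> A (fst b1)" "snd b2 \<in> A (fst b2)"
      and a: "a \<in> words (length a)" and v: "v \<in> words (length v)"
      using w by (auto simp: ub words_Cons words_append)
    let ?u = "\<nu> (snd u1) (snd u2)" and ?b = "\<nu> (snd b1) (snd b2)"
    have m: "?u \<in> A (fst u1 + fst u2 - 1)" "?b \<in> A (fst b1 + fst b2 - 1)" using mem bracket_mem by auto
    note tot = piece_total[OF m(1)] piece_total[OF m(2)] words_total[OF v] words_total[OF a]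
    have "length (u @ a) = i" using len i by simp
    then have "two_bracket_term i (u @ a @ b @ v) = scale ((-1) powi (word_degree (u @ a) - 1))
        (foldl \<mu> (\<mu> (foldl \<mu> ?u (map snd a)) ?b) (map snd v))"
      using two_bracket_term_append[of "u @ a" i b1 b2 v] by (simp add: ub leading_term_Cons)
    also have "\<mu> (foldl \<mu> ?u (map snd a)) ?b =
        scale ((-1) powi ((fst b1 + fst b2 - 1) * word_degree a)) (foldl \<mu> (\<mu> ?u ?b) (map snd a))"
      by (rule move_into_foldl[OF m a])
    also have "scale ((-1) powi (word_degree (u @ a) - 1)) (foldl \<mu> \<dots> (map snd v)) =
        scale ((-1) powi (word_degree (u @ a) - 1) * (-1) powi ((fst b1 + fst b2 - 1) * word_degree a))
          (foldl \<mu> (foldl \<mu> (\<mu> ?u ?b) (map snd a)) (map snd v))"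
      using tot by (simp add: foldl_scale foldl_closed product_closed)
    also have "(-1 :: 'k) powi (word_degree (u @ a) - 1) * (-1) powi ((fst b1 + fst b2 - 1) * word_degree a) =
        (-1) powi (word_degree a * word_degree b) * (-1) powi (word_degree u - 1)"
      by (auto simp: sign_powi ub)
    finally show "two_bracket_term i (u @ a @ b @ v) =
        scale ((-1) powi (word_degree a * word_degree b)) (two_bracket_term 2 (u @ b @ a @ v))"
      using two_bracket_term_append[of u 2 b1 b2 "a @ v"] by (simp add: ub leading_term_Cons)
  qed
  also have "\<dots> = 0" using i by (intro symmetrization_two_bracket_base[OF _ z]) simp
  finally show ?thesis .
qed

text \<open>
  The Jacobi identity for the first three letters, multiplied by the others: the unshuffles of three
  letters act on all words, and the sum of their actions is zero.
\<close>

lemma symmetrization_nested_bracket_base: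
  assumes n: "3 \<le> n" and z: "z \<in> words n"
  shows "symmetrization n (nested_bracket_term 2) z = 0"
proof -
  have perm3: "\<sigma> permutes {..<3}" if "\<sigma> \<in> unshuffles [2, 1]" for \<sigma>
    using unshuffle_permutes[OF that] by simp
  have permn: "\<sigma> permutes {..<n}" if "\<sigma> \<in> unshuffles [2, 1]" for \<sigma>
    using perm3[OF that] n by (auto intro: permutes_subset)
  have "(\<Sum>\<sigma>\<in>unshuffles [2, 1]. koszul_act (nested_bracket_term 2) \<sigma> y) = 0" if y: "y \<in> words n" for y
  proof -
    obtain u v where yuv: "y = u @ v" "length u = 3"
      using words_length[OF y] n by (metis append_take_drop_id length_take min.absorb2)
    have u: "u \<in> words 3" and v: "v \<in> words (length v)" using y yuv by (auto simp: words_append)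
    let ?J = "\<lambda>\<sigma>. \<nu> (\<nu> (snd (u ! \<sigma> 0)) (snd (u ! \<sigma> 1))) (snd (u ! \<sigma> 2))"
    have J: "?J \<sigma> \<in> tot" if "\<sigma> \<in> unshuffles [2, 1]" for \<sigma>
    proof -
      have "snd (u ! \<sigma> i) \<in> tot" if "i < 3" for i
        using permutes_in_image[OF perm3[OF \<open>\<sigma> \<in> _\<close>], of i] that words_total[OF u] yuv(2)
        by (auto simp: image_subset_iff)
      then show ?thesis by (intro bracket_closed) auto
    qed
    have act: "koszul_act (nested_bracket_term 2) \<sigma> y = foldl \<mu> (scale (koszul_sign (map fst u) \<sigma>) (?J \<sigma>)) (map snd v)"
      if s: "\<sigma> \<in> unshuffles [2, 1]" for \<sigma>
    proof -
      have p: "\<sigma> permutes {..<length u}" using perm3[OF s] yuv by simp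
      have "permute_list \<sigma> u = [u ! \<sigma> 0, u ! \<sigma> 1, u ! \<sigma> 2]"
        using yuv(2) by (simp add: permute_list_def upt_rec numeral_3_eq_3 numeral_2_eq_2)
      then show ?thesis
        using J[OF s] words_total[OF v] p koszul_sign_append[where ?'k = 'k, of \<sigma> "map fst u" "map fst v"]
          nested_bracket_term_append[of "[u ! \<sigma> 0, u ! \<sigma> 1]" 2 "u ! \<sigma> 2" v]
        by (simp add: koszul_act_def yuv(1) permute_append[OF p] leading_term_Cons foldl_scale)
    qed
    have "(\<Sum>\<sigma>\<in>unshuffles [2, 1]. koszul_act (nested_bracket_term 2) \<sigma> y) =
        foldl \<mu> (\<Sum>\<sigma>\<in>unshuffles [2, 1]. scale (koszul_sign (map fst u) \<sigma>) (?J \<sigma>)) (map snd v)"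
      using J words_total[OF v] by (simp add: act foldl_sum subspace_scale[OF subspace_total])
    also have "(\<Sum>\<sigma>\<in>unshuffles [2, 1]. scale (koszul_sign (map fst u) \<sigma>) (?J \<sigma>)) = 0"
    proof -
      have "\<sigma> i < 3" if "\<sigma> \<in> unshuffles [2, 1]" "i < 3" for \<sigma> i
        using permutes_in_image[OF perm3[OF that(1)], of i] that(2) by simp
      then show ?thesis
        using bracket_Jacobi[OF _ words_homogeneous[OF u]] yuv(2) by simp
    qed
    finally show ?thesis using words_total[OF v] by (simp add: foldl_product_zero zero_total)
  qed
  then have "symmetrization n (\<lambda>y. \<Sum>\<sigma>\<in>unshuffles [2, 1]. koszul_act (nested_bracket_term 2) \<sigma> y) z =
      symmetrization n (\<lambda>y. 0) z"
    by (intro symmetrization_cong[OF z])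
  moreover have "symmetrization n (\<lambda>y. 0) z = 0" by (simp add: symmetrization_def koszul_act_def)
  ultimately have "scale (of_nat (card (unshuffles [2, 1]))) (symmetrization n (nested_bracket_term 2) z) = 0"
    using symmetrization_sum_koszul_act[OF z permn] by simp
  moreover have "card (unshuffles [2, 1]) \<noteq> 0"
    using finite_unshuffles_two[of 2 1] id_unshuffle[of 2 1] by (auto simp: card_eq_0_iff)
  ultimately show ?thesis by simp
qed

text \<open>
  The first argument of the outer bracket is \<open>w a\<close>, where \<open>w\<close> is the leading term of \<open>i\<close> letters. The
  Leibniz rule yields \<open>w \<cdot> \<nu> a b\<close>, a two-bracket term, and \<open>\<nu> w b \<cdot> a\<close>, which is the nested term for \<open>i\<close>
  with \<open>a\<close> and \<open>b\<close> exchanged.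
\<close>

lemma symmetrization_nested_bracket:
  assumes "2 \<le> i" "i < n" and z: "z \<in> words n"
  shows "symmetrization n (nested_bracket_term i) z = 0"
  using assms(1,2)
proof (induction i rule: dec_induct)
  case base
  then show ?case by (intro symmetrization_nested_bracket_base z) simp
next
  case (step i)
  let ?s = "swap_blocks i 1 1"
  have "nested_bracket_term (Suc i) y = two_bracket_term i y + koszul_act (nested_bracket_term i) ?s y"
    if y: "y \<in> words n" for y
  proof -
    obtain u a' b' v where "y = u @ a' @ b' @ v" and len: "length u = i" "length a' = 1" "length b' = 1"
      by (rule words_blocksE[OF y, of i 1 1]) (use step.prems in auto)
    moreover from len obtain a b where "a' = [a]" "b' = [b]"
      by (metis One_nat_def length_0_conv length_Suc_conv)
    ultimately have yuv: "y = u @ [a] @ [b] @ v" by simp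
    let ?w = "leading_term (map snd u)"
    have a: "snd a \<in> A (fst a)" and b: "snd b \<in> A (fst b)" and u: "u \<in> words i" and v: "v \<in> words (length v)"
      using y len by (auto simp: yuv words_append words_Cons)
    have w: "?w \<in> A (word_degree u - 1)" using leading_term_mem[OF u] step.hyps by simp
    note tot = piece_total[OF a] piece_total[OF b] piece_total[OF w] words_total[OF v]
    have "leading_term (map snd (u @ [a])) = \<mu> ?w (snd a)"
      by (rule words_at_least_two[OF u \<open>2 \<le> i\<close>]) (simp add: leading_term_Cons)
    then have "nested_bracket_term (Suc i) y = foldl \<mu> (\<nu> (\<mu> ?w (snd a)) (snd b)) (map snd v)"
      using nested_bracket_term_append[of "u @ [a]" "Suc i" b v] len by (simp add: yuv)
    also have "\<dots> = scale ((-1) powi (word_degree u - 1)) (foldl \<mu> (\<mu> ?w (\<nu> (snd a) (snd b))) (map snd v)) +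
        scale ((-1) powi (fst a * fst b)) (foldl \<mu> (\<mu> (\<nu> ?w (snd b)) (snd a)) (map snd v))"
      unfolding bracket_Leibniz_right[OF w a b]
      using tot by (simp add: foldl_add foldl_scale product_closed bracket_closed subspace_scale[OF subspace_total])
    finally show ?thesis
      using two_bracket_term_append[of u i a b v] nested_bracket_term_append[of u i b "a # v"] len
        koszul_act_swap_blocks[of "nested_bracket_term i" u "[a]" "[b]" v]
      by (simp add: yuv)
  qed
  then have "symmetrization n (nested_bracket_term (Suc i)) z =
      symmetrization n (\<lambda>y. two_bracket_term i y + koszul_act (nested_bracket_term i) ?s y) z"
    by (intro symmetrization_cong[OF z])
  also have "\<dots> = 0"
    using step symmetrization_two_bracket[OF step.hyps(1) _ z]
      symmetrization_koszul_act[OF z swap_blocks_permutes[of i 1 1 n]]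
    by (simp add: symmetrization_add)
  finally show ?case .
qed

text \<open>
  The word to which the outer bracket is applied: the leading term of the first \<open>i\<close> letters becomes one
  letter.
\<close>

definition contract :: "nat \<Rightarrow> (int \<times> 'a) list \<Rightarrow> (int \<times> 'a) list" where
  "contract i z = (word_degree (take i z) - 1, leading_term (map snd (take i z))) # drop i z"

lemma words_take: "z \<in> words n \<Longrightarrow> i \<le> n \<Longrightarrow> take i z \<in> words i"
  by (auto simp: words_def dest: in_set_takeD)

lemma words_drop: "z \<in> words n \<Longrightarrow> drop i z \<in> words (n - i)"
  by (auto simp: words_def dest: in_set_dropD)

lemma contract_words:
  assumes "z \<in> words n" "2 \<le> i" "i \<le> n"
  shows "contract i z \<in> words (Suc (n - i))"
  using leading_term_mem[OF words_take[OF assms(1,3)] assms(2)] words_drop[OF assms(1), of i]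
    words_length[OF assms(1)]
  by (simp add: contract_def words_Cons)

text \<open>
  A permutation of the contracted word that fixes the contracted letter comes from a permutation of the
  original word, which the symmetrization absorbs.
\<close>

lemma symmetrization_lift:
  assumes i: "2 \<le> i" "i \<le> n" and z: "z \<in> words n"
    and \<rho>: "\<rho> permutes {..<Suc (n - i)}" "\<rho> 0 = 0"
  shows "symmetrization n (\<lambda>z. koszul_act g \<rho> (contract i z)) z = symmetrization n (\<lambda>z. g (contract i z)) z"
proof -
  obtain \<tau> where \<tau>: "\<tau> permutes {..<n - i}" "\<rho> = shift_perm 1 \<tau>" using permutes_fix_zeroE[OF \<rho>] .
  have perm: "shift_perm i \<tau> permutes {..<n}"
    by (rule permutes_subset[OF shift_perm_permutes[OF \<tau>(1)]]) (use i in auto)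
  have "koszul_act g \<rho> (contract i y) = koszul_act (\<lambda>z. g (contract i z)) (shift_perm i \<tau>) y"
    if y: "y \<in> words n" for y
  proof -
    let ?u = "take i y" and ?v = "drop i y" and ?p = "(word_degree (take i y) - 1, leading_term (map snd (take i y)))"
    have len: "length ?u = i" "length ?v = n - i" using words_length[OF y] i by auto
    have t: "\<tau> permutes {..<length ?v}" "\<tau> permutes {..<length (map fst ?v)}" using \<tau>(1) len by auto
    have "permute_list \<rho> (contract i y) = ?p # permute_list \<tau> ?v"
      using permute_shift_perm[OF t(1), of "[?p]"] by (simp add: contract_def \<tau>(2))
    moreover have "(koszul_sign (map fst (contract i y)) \<rho> :: 'k) = koszul_sign (map fst ?v) \<tau>"
      using koszul_sign_shift_perm[where ?'k = 'k, OF t(2), of "[fst ?p]"] by (simp add: contract_def \<tau>(2))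
    moreover have "permute_list (shift_perm i \<tau>) y = ?u @ permute_list \<tau> ?v"
      using permute_shift_perm[OF t(1), of ?u] len(1) by simp
    moreover have "(koszul_sign (map fst y) (shift_perm i \<tau>) :: 'k) = koszul_sign (map fst ?v) \<tau>"
      using koszul_sign_shift_perm[where ?'k = 'k, OF t(2), of "map fst ?u"] len(1)
      by (simp flip: map_append)
    ultimately show ?thesis using len(1) by (simp add: koszul_act_def contract_def)
  qed
  then have "symmetrization n (\<lambda>z. koszul_act g \<rho> (contract i z)) z =
      symmetrization n (koszul_act (\<lambda>z. g (contract i z)) (shift_perm i \<tau>)) z"
    by (intro symmetrization_cong[OF z])
  then show ?thesis using symmetrization_koszul_act[OF z perm] by simp
qed

text \<open>
  An unshuffle with blocks of length \<open>2\<close> and \<open>n - i - 1\<close> brings the contracted letter to the front of one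
  of the blocks. In the first block the letter is an argument of the bracket, and the term is a nested
  bracket; in the second it is the first factor after the bracket, and exchanging it with the bracket
  gives a two-bracket term.
\<close>

lemma symmetrization_unshuffled_contract:
  assumes i: "2 \<le> i" "i < n" and z: "z \<in> words n" and \<pi>: "\<pi> \<in> unshuffles [2, n - i - 1]"
  shows "symmetrization n (\<lambda>z. koszul_act (\<lambda>z. leading_term (map snd z)) \<pi> (contract i z)) z = 0"
proof -
  let ?T = "\<lambda>z :: (int \<times> 'a) list. leading_term (map snd z)" and ?j = "Suc (n - i)"
  have perm: "\<pi> permutes {..<?j}" using unshuffle_permutes[OF \<pi>, of ?j] i by simp
  have mono: "\<pi> k < \<pi> (Suc k)" if "Suc k < ?j" "Suc k \<noteq> 2" for k
    using \<pi> that i by (auto simp: unshuffles_two_iff)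
  show ?thesis
  proof (cases "\<pi> 0 = 0")
    case True
    have "symmetrization n (\<lambda>z. koszul_act ?T \<pi> (contract i z)) z = symmetrization n (\<lambda>z. ?T (contract i z)) z"
      using i by (intro symmetrization_lift[OF _ _ z perm True]) auto
    also have "(\<lambda>z. ?T (contract i z)) = nested_bracket_term i"
      by (simp add: fun_eq_iff contract_def nested_bracket_term_def)
    finally show ?thesis using symmetrization_nested_bracket[OF i z] by simp
  next
    case False
    let ?c = "swap_blocks 0 1 2"
    obtain k where k: "\<pi> k = 0" "k < ?j"
      using permutes_image[OF perm] by (metis imageE lessThan_iff zero_less_Suc)
    \<comment> \<open>only the first position of a block can carry the smallest letter\<close>
    have "k = 2"
    proof (rule ccontr)
      assume "k \<noteq> 2"
      moreover from False k have "k \<noteq> 0" by metis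
      ultimately show False using mono[of "k - 1"] k by simp
    qed
    then have j: "i + 2 \<le> n" using k by simp
    have c: "?c permutes {..<?j}" using j by (intro swap_blocks_permutes) simp
    \<comment> \<open>split off the exchange of the contracted letter with the two letters in front of it\<close>
    define \<rho> where "\<rho> = \<pi> \<circ> inv ?c"
    have \<rho>: "\<rho> permutes {..<?j}" unfolding \<rho>_def by (rule permutes_compose[OF permutes_inv[OF c] perm])
    have "inv ?c 0 = 2" using permutes_inverses(2)[OF c, of 2] by (simp add: swap_blocks_def)
    then have \<rho>0: "\<rho> 0 = 0" using k \<open>k = 2\<close> by (simp add: \<rho>_def)
    have \<pi>_eq: "\<pi> = \<rho> \<circ> ?c" using permutes_inv_o(2)[OF c] by (simp add: \<rho>_def o_assoc[symmetric])
    have "koszul_act ?T \<pi> (contract i y) = koszul_act (koszul_act ?T ?c) \<rho> (contract i y)" if "y \<in> words n" for y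
      unfolding \<pi>_eq using koszul_act_compose[OF contract_words[OF that] \<rho> c] i by simp
    then have "symmetrization n (\<lambda>z. koszul_act ?T \<pi> (contract i z)) z =
        symmetrization n (\<lambda>z. koszul_act (koszul_act ?T ?c) \<rho> (contract i z)) z"
      by (intro symmetrization_cong[OF z])
    also have "\<dots> = symmetrization n (\<lambda>z. koszul_act ?T ?c (contract i z)) z"
      using i by (intro symmetrization_lift[OF _ _ z \<rho> \<rho>0]) auto
    also have "\<dots> = symmetrization n (two_bracket_term i) z"
    proof (rule symmetrization_cong[OF z])
      fix y assume y: "y \<in> words n"
      \<comment> \<open>the third block is empty, only the two letters after the first \<open>i\<close> matter\<close>
      obtain u b' v e where "y = u @ b' @ e @ v" and len: "length u = i" "length b' = 2" "length e = 0"
        by (rule words_blocksE[OF y, of i 2 0]) (use j in auto)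
      moreover from len obtain a b where "b' = [a, b]" using length_two by metis
      ultimately have yuv: "y = u @ a # b # v" by simp
      let ?w = "leading_term (map snd u)" and ?d = "word_degree u - 1" and ?b = "\<nu> (snd a) (snd b)"
      have a: "snd a \<in> A (fst a)" and b: "snd b \<in> A (fst b)" and u: "u \<in> words i" and v: "v \<in> words (length v)"
        using y len by (auto simp: yuv words_append words_Cons)
      have w: "?w \<in> A ?d" using leading_term_mem[OF u] i by simp
      note m = bracket_mem[OF a b]
      note tot = piece_total[OF m] piece_total[OF w] words_total[OF v]
      have "koszul_act ?T ?c (contract i y) =
          scale ((-1) powi (?d * (fst a + fst b))) (foldl \<mu> (\<mu> ?b ?w) (map snd v))"
        using koszul_act_swap_blocks[of ?T "[]" "[(?d, ?w)]" "[a, b]" v] len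
        by (simp add: contract_def yuv leading_term_Cons numeral_2_eq_2)
      also have "\<mu> ?b ?w = scale ((-1) powi ((fst a + fst b - 1) * ?d)) (\<mu> ?w ?b)"
        by (rule product_commute[OF m w])
      also have "scale ((-1) powi (?d * (fst a + fst b))) (foldl \<mu> \<dots> (map snd v)) =
          scale ((-1) powi (?d * (fst a + fst b)) * (-1) powi ((fst a + fst b - 1) * ?d)) (foldl \<mu> (\<mu> ?w ?b) (map snd v))"
        using tot by (simp add: foldl_scale product_closed)
      also have "(-1 :: 'k) powi (?d * (fst a + fst b)) * (-1) powi ((fst a + fst b - 1) * ?d) = (-1) powi ?d"
        by (auto simp: sign_powi)
      finally show "koszul_act ?T ?c (contract i y) = two_bracket_term i y"
        using two_bracket_term_append[of u i a b v] len by (simp add: yuv)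
    qed
    also have "\<dots> = 0" using symmetrization_two_bracket[OF i(1) j z] .
    finally show ?thesis .
  qed
qed

text \<open>
  Neighbours on the same side of position \<open>i\<close> are arguments of the same bracket, so graded symmetry of
  the inner or of the outer bracket applies.
\<close>

lemma higher_bracket_nested_swap_invariant:
  assumes i: "2 \<le> i" "i < n" and k: "Suc k \<noteq> i" "Suc k < n"
  shows "swap_invariant n (\<lambda>z. hb (Suc (n - i)) (hb i (map snd (take i z)) # map snd (drop i z))) k"
  unfolding swap_invariant_def
proof (intro allI impI)
  fix u a b v assume z: "u @ [a, b] @ v \<in> words n" and len: "length u = k"
  let ?s = "(-1 :: 'k) powi (fst a * fst b)"
  note inv = graded_symmetric_swap_invariant[OF higher_bracket_symmetric, unfolded swap_invariant_def, rule_format]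
  note take = words_take[OF z less_imp_le[OF i(2)]] and drop = words_drop[OF z, of i]
  show "hb (Suc (n - i)) (hb i (map snd (take i (u @ [a, b] @ v))) # map snd (drop i (u @ [a, b] @ v))) =
      scale ?s (hb (Suc (n - i)) (hb i (map snd (take i (u @ [b, a] @ v))) # map snd (drop i (u @ [b, a] @ v))))"
  proof (cases "Suc k < i")
    case True
    obtain m where m: "i = k + Suc (Suc m)" using less_imp_Suc_add[OF True] by auto
    have t: "take i (u @ [x, y] @ v) = u @ [x, y] @ take m v" "drop i (u @ [x, y] @ v) = drop m v" for x y
      using len by (simp_all add: m)
    have w: "u @ [a, b] @ take m v \<in> words i" "drop m v \<in> words (n - i)" using take drop unfolding t .
    have w': "u @ [b, a] @ take m v \<in> words i" using w(1) by (auto simp: words_append words_Cons)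
    have "hb i (map snd (u @ [a, b] @ take m v)) = scale ?s (hb i (map snd (u @ [b, a] @ take m v)))"
      by (rule inv[OF w(1) refl])
    then show ?thesis
      unfolding t
      using multilinear_map_scale_Cons[OF higher_bracket_multilinear _ words_total[OF w(2)]
          piece_total[OF higher_bracket_mem[OF i(1) w']]] words_length[OF w(2)]
      by (simp del: append_Cons map_append)
  next
    case False
    then have "i \<le> k" using k by simp
    then have t: "take i (u @ [x, y] @ v) = take i u" "drop i (u @ [x, y] @ v) = drop i u @ [x, y] @ v" for x y
      using len by simp_all
    let ?p = "(word_degree (take i u) - 1, hb i (map snd (take i u)))"
    have w: "take i u \<in> words i" "drop i u @ [a, b] @ v \<in> words (n - i)" using take drop unfolding t .
    have "(?p # drop i u) @ [a, b] @ v \<in> words (Suc (n - i))"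
      using w(2) higher_bracket_mem[OF i(1) w(1)] by (auto simp: words_Cons words_append)
    from inv[OF this refl] show ?thesis unfolding t by simp
  qed
qed

text \<open>
  The sum is a symmetrization up to a nonzero factor. There the inner bracket may be replaced by its
  leading term, as all its summands have the same symmetrization; expanding the outer bracket then leaves
  the terms of \<open>symmetrization_unshuffled_contract\<close>.
\<close>

lemma higher_bracket_Jacobi_summand:
  assumes i: "2 \<le> i" and j: "2 \<le> j" and ij: "i + j = n + 1" and z: "z \<in> words n"
  shows "(\<Sum>\<sigma>\<in>unshuffles [i, j - 1].
    koszul_act (\<lambda>z. hb j (hb i (map snd (take i z)) # map snd (drop i z))) \<sigma> z) = 0"
proof -
  let ?T = "\<lambda>z. leading_term (map snd z)"
  let ?H = "\<lambda>z. hb j (hb i (map snd (take i z)) # map snd (drop i z))"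
  let ?H1 = "\<lambda>z. hb j (map snd (contract i z))"
  have n: "i < n" "j = Suc (n - i)" "n = i + (j - 1)" using i j ij by auto
  have perm: "\<sigma> permutes {..<i}" if "\<sigma> \<in> unshuffles [2, i - 2]" for \<sigma>
    using unshuffle_permutes[OF that, of i] i by simp
  have permn: "\<sigma> permutes {..<n}" if "\<sigma> \<in> unshuffles [2, i - 2]" for \<sigma>
    using perm[OF that] n(1) by (auto intro: permutes_subset)
  have expand: "?H y = (\<Sum>\<sigma>\<in>unshuffles [2, i - 2]. koszul_act ?H1 \<sigma> y)" if y: "y \<in> words n" for y
  proof -
    let ?u = "take i y" and ?v = "drop i y"
    have u: "?u \<in> words i" and v: "?v \<in> words (n - i)" using words_take[OF y] words_drop[OF y] n(1) by auto
    have lin: "multilinear_map scale A (Suc (n - i)) (hb j)" using higher_bracket_multilinear[of j] n(2) by simp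
    have len: "length (map snd ?v) = n - i" using words_length[OF v] by simp
    have T: "leading_term (map snd (permute_list \<sigma> ?u)) \<in> tot" if "\<sigma> \<in> unshuffles [2, i - 2]" for \<sigma>
      using piece_total[OF leading_term_mem[OF words_permute[OF u perm[OF that]] i]] .
    have act: "koszul_act ?H1 \<sigma> y = hb j (koszul_act ?T \<sigma> ?u # map snd ?v)"
      if s: "\<sigma> \<in> unshuffles [2, i - 2]" for \<sigma>
    proof -
      have p: "\<sigma> permutes {..<length ?u}" "\<sigma> permutes {..<length (map fst ?u)}"
        using perm[OF s] words_length[OF u] by auto
      have "permute_list \<sigma> y = permute_list \<sigma> ?u @ ?v" using permute_append[OF p(1), of ?v] by simp
      moreover have "(koszul_sign (map fst y) \<sigma> :: 'k) = koszul_sign (map fst ?u) \<sigma>"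
        using koszul_sign_append[where ?'k = 'k, OF p(2), of "map fst ?v"] by (simp flip: map_append)
      ultimately show ?thesis
        using words_length[OF u] multilinear_map_scale_Cons[OF lin len words_total[OF v] T[OF s]]
        by (simp add: koszul_act_def contract_def)
    qed
    have "?H y = hb j ((\<Sum>\<sigma>\<in>unshuffles [2, i - 2]. koszul_act ?T \<sigma> ?u) # map snd ?v)"
      by (simp add: higher_bracket_unshuffles[OF i u])
    also have "\<dots> = (\<Sum>\<sigma>\<in>unshuffles [2, i - 2]. hb j (koszul_act ?T \<sigma> ?u # map snd ?v))"
      using T by (intro multilinear_map_sum_Cons[OF lin len words_total[OF v]])
        (simp add: koszul_act_def subspace_scale[OF subspace_total])
    finally show ?thesis by (simp add: act)
  qed
  have "symmetrization n ?H1 z =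
      symmetrization n (\<lambda>z. \<Sum>\<pi>\<in>unshuffles [2, j - 2]. koszul_act ?T \<pi> (contract i z)) z"
    using contract_words[OF _ i] n(1,2) j by (intro symmetrization_cong[OF z] higher_bracket_unshuffles) auto
  also have "\<dots> = 0"
    unfolding symmetrization_sum
    using symmetrization_unshuffled_contract[OF i n(1) z] n(2) by (intro sum.neutral) simp
  finally have H1: "symmetrization n ?H1 z = 0" .
  have "symmetrization n ?H z = symmetrization n (\<lambda>y. \<Sum>\<sigma>\<in>unshuffles [2, i - 2]. koszul_act ?H1 \<sigma> y) z"
    by (intro symmetrization_cong[OF z] expand)
  also have "\<dots> = 0" using symmetrization_sum_koszul_act[OF z permn] H1 by simp
  finally have "symmetrization n ?H z = 0" .
  moreover have "symmetrization n ?H z =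
      scale (fact i * fact (j - 1)) (\<Sum>\<sigma>\<in>unshuffles [i, j - 1]. koszul_act ?H \<sigma> z)"
    using higher_bracket_nested_swap_invariant[OF i n(1)] z n(2)
    by (intro symmetrization_unshuffles[of i "j - 1", folded n(3)]) auto
  ultimately show ?thesis by simp
qed

lemma higher_bracket_zero:
  assumes "length xs = n" "set xs \<subseteq> tot" "0 \<in> set xs"
  shows "hb n xs = 0"
  by (rule multilinear_map_zero[OF higher_bracket_multilinear assms])

lemma higher_bracket_Jacobi:
  assumes xs: "length xs = n" and hom: "homogeneous A ds xs"
  shows "(\<Sum>(i, j) \<in> {(i, j). 1 \<le> i \<and> 1 \<le> j \<and> i + j = n + 1}. \<Sum>\<sigma>\<in>unshuffles [i, j - 1].
    scale (koszul_sign ds \<sigma>)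
      (hb j (hb i (take i (permute_list \<sigma> xs)) # drop i (permute_list \<sigma> xs)))) = 0"
proof (rule sum.neutral, clarify)
  fix i j assume ij: "1 \<le> i" "1 \<le> j" "i + j = n + 1"
  note z = words_zip[OF hom xs]
  have perm: "\<sigma> permutes {..<n}" if "\<sigma> \<in> unshuffles [i, j - 1]" for \<sigma>
    using unshuffle_permutes[OF that, of n] ij by simp
  consider "i = 1" | "j = 1" | "2 \<le> i" "2 \<le> j" using ij by linarith
  then show "(\<Sum>\<sigma>\<in>unshuffles [i, j - 1]. scale (koszul_sign ds \<sigma>)
      (hb j (hb i (take i (permute_list \<sigma> xs)) # drop i (permute_list \<sigma> xs)))) = 0"
  proof cases
    case 1
    have "hb j (hb i (take i (permute_list \<sigma> xs)) # drop i (permute_list \<sigma> xs)) = 0"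
      if "\<sigma> \<in> unshuffles [i, j - 1]" for \<sigma>
    proof (rule higher_bracket_zero)
      show "length (hb i (take i (permute_list \<sigma> xs)) # drop i (permute_list \<sigma> xs)) = j" using xs 1 ij by simp
      have "set (permute_list \<sigma> xs) \<subseteq> tot"
        using words_total[OF z(1)] z(3) perm[OF that] xs by simp
      then show "set (hb i (take i (permute_list \<sigma> xs)) # drop i (permute_list \<sigma> xs)) \<subseteq> tot"
        using 1 zero_total set_drop_subset[of i "permute_list \<sigma> xs"] by (auto simp: higher_bracket_def)
    qed (simp add: 1 higher_bracket_def)
    then show ?thesis by simp
  next
    case 2
    then show ?thesis by (simp add: higher_bracket_def)
  next
    case 3
    have "map snd (permute_list \<sigma> (zip ds xs)) = permute_list \<sigma> xs" if "\<sigma> \<in> unshuffles [i, j - 1]" for \<sigma>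
      using perm[OF that] z(3) words_length[OF z(1)] by (metis permute_list_map)
    then show ?thesis
      using higher_bracket_Jacobi_summand[OF 3 ij(3) z(1)] z(2)
      by (simp add: koszul_act_def take_map[symmetric] drop_map[symmetric])
  qed
qed

end

section \<open>Restriction to positive degrees\<close>

lemma graded_vector_space_positive_part:
  assumes "graded_vector_space scale V"
  shows "graded_vector_space scale (positive_part V)"
proof -
  interpret graded_vector_space scale V by fact
  show ?thesis
  proof
    show "subspace (positive_part V i)" for i
      using subspace_piece by (simp add: positive_part_def subspace_single_0)
    fix I f i
    assume "finite I" "\<And>i. i \<in> I \<Longrightarrow> f i \<in> positive_part V i" "(\<Sum>i\<in>I. f i) = 0" "i \<in> I"
    then show "f i = 0"
      using independent_pieces[of I f i] subspace_0[OF subspace_piece]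
      by (metis (full_types) positive_part_def singletonD)
  qed
qed

context graded_vector_space begin

text \<open>
  The degree condition concerns homogeneous arguments only. They are replaced by elements of the span one
  position after the other, by linearity in that position.
\<close>

lemma multilinear_map_restrict:
  assumes W: "graded_vector_space scale W" "\<And>i. W i \<subseteq> V i"
    and g: "multilinear_map scale V n g" and deg: "has_degree W n g m"
  shows "multilinear_map scale W n g"
proof -
  interpret W: graded_vector_space scale W by fact
  have sub: "total scale W \<subseteq> tot" unfolding total_def using W(2) by (intro span_mono) blast
  \<comment> \<open>the first \<open>k\<close> arguments are arbitrary, the others are still homogeneous\<close>
  have closed: "\<lbrakk>length xs = n; \<And>i. i < k \<Longrightarrow> i < n \<Longrightarrow> xs ! i \<in> total scale W;
      \<And>i. k \<le> i \<Longrightarrow> i < n \<Longrightarrow> \<exists>d. xs ! i \<in> W d\<rbrakk> \<Longrightarrow> g xs \<in> total scale W" for xs k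
  proof (induction k arbitrary: xs)
    case 0
    then obtain d where d: "\<And>i. i < n \<Longrightarrow> xs ! i \<in> W (d i)" by (metis le0)
    have "homogeneous W (map d [0..<n]) xs"
      using 0(1) d by (simp add: homogeneous_def list_all2_conv_all_nth)
    then show ?case using deg 0(1) W.piece_total unfolding has_degree_def by blast
  next
    case (Suc k)
    show ?case
    proof (cases "k < n")
      case False
      then show ?thesis using Suc by (intro Suc.IH) auto
    next
      case True
      have xs: "set xs \<subseteq> tot"
      proof
        fix x assume "x \<in> set xs"
        then obtain i where "i < n" "x = xs ! i" using Suc.prems(1) by (auto simp: in_set_conv_nth)
        then have "x \<in> total scale W" using Suc.prems(2)[of i] Suc.prems(3)[of i] W.piece_total by (cases "i < Suc k") auto
        then show "x \<in> tot" using sub by blast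
      qed
      have "x \<in> total scale W \<and> g (xs[k := x]) \<in> total scale W" if "x \<in> span (\<Union>i. W i)" for x
        using that
      proof (induction rule: span_induct_alt)
        case base
        have "g (xs[k := 0]) = 0"
          using Suc.prems(1) xs True set_update_subset_insert[of xs k 0] subspace_0[OF subspace_total]
          by (intro multilinear_map_zero[OF g]) (auto simp: set_update_memI)
        then show ?case using subspace_0[OF W.subspace_total] by simp
      next
        case (step c x y)
        then obtain d where x: "x \<in> W d" by blast
        have xy: "x \<in> tot" "y \<in> tot" using W.piece_total[OF x] step(2) sub by auto
        have "g (xs[k := x]) \<in> total scale W"
          using Suc.prems x True by (intro Suc.IH) (auto simp: nth_list_update)
        then show ?case
          using step(2) W.piece_total[OF x] xy Suc.prems(1) True xs subspace_scale[OF subspace_total]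
          by (simp add: multilinear_map_add[OF g] multilinear_map_scale[OF g]
              subspace_add[OF W.subspace_total] subspace_scale[OF W.subspace_total])
      qed
      moreover have "xs ! k \<in> span (\<Union>i. W i)" using Suc.prems(2)[of k] True by (simp add: total_def)
      ultimately show ?thesis by (metis list_update_id)
    qed
  qed
  show ?thesis
  proof (rule W.multilinear_mapI)
    show "g xs \<in> total scale W" if "length xs = n" "set xs \<subseteq> total scale W" for xs
      using that by (intro closed[of xs n]) auto
  qed (use sub in \<open>auto intro!: multilinear_map_add[OF g] multilinear_map_scale[OF g]\<close>)
qed

end

theorem theorem2p1:
  fixes scale :: "'k::field_char_0 \<Rightarrow> 'a::ab_group_add \<Rightarrow> 'a"
    and A :: "int \<Rightarrow> 'a set"
    and \<nu> \<mu> :: "'a \<Rightarrow> 'a \<Rightarrow> 'a"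
  assumes "Gerstenhaber_algebra scale A \<nu> \<mu>"
  shows "L_infinity_algebra scale (positive_part A) (higher_bracket scale A \<nu> \<mu>)"
proof -
  interpret Gerstenhaber_algebra scale A \<nu> \<mu> by fact
  let ?L = "positive_part A"
  have L: "graded_vector_space scale ?L"
    by (rule graded_vector_space_positive_part) (rule graded_vector_space_axioms)
  interpret L: graded_vector_space scale ?L by (rule L)
  have sub: "?L i \<subseteq> A i" for i
    using subspace_0[OF subspace_piece] by (auto simp: positive_part_def)
  have hom: "homogeneous A ds xs" if "homogeneous ?L ds xs" for ds xs
    using that sub unfolding homogeneous_def by (auto elim!: list_all2_mono)
  have deg: "has_degree ?L n (hb n) (-1)" for n
    unfolding has_degree_def
  proof (intro allI impI)
    fix ds xs assume len: "length xs = n" and h: "homogeneous ?L ds xs"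
    note z = words_zip[OF hom[OF h] len]
    consider "n \<le> 1" | "0 \<in> set xs" | "2 \<le> n" "0 \<notin> set xs" by linarith
    then show "hb n xs \<in> ?L (sum_list ds + - 1)"
    proof cases
      case 1
      then show ?thesis using subspace_0[OF L.subspace_piece] by (simp add: higher_bracket_def)
    next
      case 2
      then have "hb n xs = 0" using higher_bracket_zero[OF len] words_total[OF z(1)] z(3) by simp
      then show ?thesis using subspace_0[OF L.subspace_piece] by simp
    next
      case 3
      have "1 \<le> d" if "d \<in> set ds" for d
      proof -
        obtain k where "k < length ds" "d = ds ! k" using \<open>d \<in> set ds\<close> by (auto simp: in_set_conv_nth)
        then have "xs ! k \<in> ?L d" "xs ! k \<in> set xs" using h by (auto simp: homogeneous_def list_all2_conv_all_nth)
        moreover from this 3 have "xs ! k \<noteq> 0" by metis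
        ultimately show ?thesis by (auto simp: positive_part_def split: if_splits)
      qed
      then have "int (length ds) \<le> sum_list ds"
        using sum_list_mono[of ds "\<lambda>_. 1" id] by (simp add: sum_list_triv)
      moreover have "length ds = n" using h len by (auto simp: homogeneous_def list_all2_lengthD)
      ultimately have "0 < sum_list ds - 1" using 3 by simp
      then show ?thesis
        using higher_bracket_mem[OF 3(1) z(1)] z(2,3) by (simp add: positive_part_def word_degree_def)
    qed
  qed
  show ?thesis
  proof
    show "?L i = {0}" if "i \<le> 0" for i using that by (simp add: positive_part_def)
    show "multilinear_map scale ?L n (hb n)" if "1 \<le> n" for n
      by (rule multilinear_map_restrict[OF L sub higher_bracket_multilinear deg])
    show "has_degree ?L n (hb n) (-1)" if "1 \<le> n" for n by (rule deg)
    show "graded_symmetric scale ?L n (hb n)" if "1 \<le> n" for n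
      using higher_bracket_symmetric[of n] hom unfolding graded_symmetric_def by blast
    show "(\<Sum>(i, j) \<in> {(i, j). 1 \<le> i \<and> 1 \<le> j \<and> i + j = n + 1}. \<Sum>\<sigma>\<in>unshuffles [i, j - 1].
          scale (koszul_sign ds \<sigma>)
            (hb j (hb i (take i (permute_list \<sigma> xs)) # drop i (permute_list \<sigma> xs)))) = 0"
      if "1 \<le> n" "length xs = n" "homogeneous ?L ds xs" for n xs ds
      by (rule higher_bracket_Jacobi[OF that(2) hom[OF that(3)]])
  qed
qed

end
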